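(* Let $k$ be a fixed positive integer. There is a constant $C_k>0$ (depending only on $k$) such that for every Johnson graph $J(n,k)$, with $N=\binom{n}{k}$ vertices and Laplacian matrix $L$, there is a quantum search algorithm whose parameters depend only on $n$ and $k$ (not on the marked vertex) and which, for every marked vertex $m$, deterministically (with success probability exactly $1$) finds $m$ using at most $C_k\sqrt N$ calls to the search operator $e^{-i\theta|m\rangle\langle m|}$. Concretely, starting from $|s\rangle=\frac{1}{\sqrt N}\sum_{v}|v\rangle$, the algorithm applies a sequence of continuous-time quantum walk operators $e^{-iLt}$ ($t\in\mathbb R$) alternated with search operators $e^{-i\theta|m\rangle\langle m|}$ ($\theta\in\mathbb R$) and produces the state $|m\rangle$ up to a global phase.
   Context: The Johnson graph $J(n,k)$ has as vertices the $k$-element subsets of $\{1,\dots,n\}$, two vertices being adjacent when their intersection has size $k-1$. The Laplacian is $L=D-A$ with $D$ the diagonal degree matrix and $A$ the adjacency matrix. States live in the Hilbert space spanned by the orthonormal vertex basis $\{|v\rangle\}$; the marked vertex $m$ is accessible only through the search operator $e^{-i\theta|m\rangle\langle m|}$. *)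

theory Defs
  imports "HOL-Analysis.Analysis"
begin

definition johnson_vertices :: "nat \<Rightarrow> nat \<Rightarrow> nat set set" where
  "johnson_vertices n k = {A. A \<subseteq> {1..n} \<and> card A = k}"

definition johnson_adj :: "nat \<Rightarrow> nat set \<Rightarrow> nat set \<Rightarrow> bool" where
  "johnson_adj k A B \<longleftrightarrow> card (A \<inter> B) = k - 1"

text \<open>Matrices/operators on the Hilbert space spanned by the vertex set V
  are represented as functions V => V => complex; states as V => complex.\<close>
definition mmult :: "'v set \<Rightarrow> ('v \<Rightarrow> 'v \<Rightarrow> complex) \<Rightarrow> ('v \<Rightarrow> 'v \<Rightarrow> complex) \<Rightarrow> ('v \<Rightarrow> 'v \<Rightarrow> complex)" where
  "mmult V A B = (\<lambda>i j. \<Sum>l\<in>V. A i l * B l j)"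

definition mident :: "'v \<Rightarrow> 'v \<Rightarrow> complex" where
  "mident = (\<lambda>i j. if i = j then 1 else 0)"

fun mpow :: "'v set \<Rightarrow> ('v \<Rightarrow> 'v \<Rightarrow> complex) \<Rightarrow> nat \<Rightarrow> ('v \<Rightarrow> 'v \<Rightarrow> complex)" where
  "mpow V A 0 = mident"
| "mpow V A (Suc p) = mmult V A (mpow V A p)"

definition mexp :: "'v set \<Rightarrow> ('v \<Rightarrow> 'v \<Rightarrow> complex) \<Rightarrow> ('v \<Rightarrow> 'v \<Rightarrow> complex)" where
  "mexp V A = (\<lambda>i j. \<Sum>p. mpow V A p i j / of_nat (fact p))"

definition mapply :: "'v set \<Rightarrow> ('v \<Rightarrow> 'v \<Rightarrow> complex) \<Rightarrow> ('v \<Rightarrow> complex) \<Rightarrow> ('v \<Rightarrow> complex)" where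
  "mapply V M x = (\<lambda>i. \<Sum>j\<in>V. M i j * x j)"

definition johnson_laplacian :: "nat \<Rightarrow> nat \<Rightarrow> nat set \<Rightarrow> nat set \<Rightarrow> complex" where
  "johnson_laplacian n k = (\<lambda>u v.
     (if u = v then of_nat (card {w \<in> johnson_vertices n k. johnson_adj k u w}) else 0)
     - (if johnson_adj k u v then 1 else 0))"

definition proj :: "'v \<Rightarrow> 'v \<Rightarrow> 'v \<Rightarrow> complex" where
  "proj m = (\<lambda>i j. if i = m \<and> j = m then 1 else 0)"

definition walk_op :: "nat \<Rightarrow> nat \<Rightarrow> real \<Rightarrow> nat set \<Rightarrow> nat set \<Rightarrow> complex" where
  "walk_op n k t = mexp (johnson_vertices n k) (\<lambda>u v. - \<i> * of_real t * johnson_laplacian n k u v)"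

definition search_op :: "nat \<Rightarrow> nat \<Rightarrow> nat set \<Rightarrow> real \<Rightarrow> nat set \<Rightarrow> nat set \<Rightarrow> complex" where
  "search_op n k m \<theta> = mexp (johnson_vertices n k) (\<lambda>u v. - \<i> * of_real \<theta> * proj m u v)"

definition unif_state :: "nat \<Rightarrow> nat \<Rightarrow> nat set \<Rightarrow> complex" where
  "unif_state n k = (\<lambda>v. if v \<in> johnson_vertices n k
      then 1 / of_real (sqrt (real (card (johnson_vertices n k)))) else 0)"

definition basis_state :: "'v \<Rightarrow> 'v \<Rightarrow> complex" where
  "basis_state m = (\<lambda>v. if v = m then 1 else 0)"

text \<open>The algorithm with parameters t0 and steps [(theta_1,t_1),...,(theta_r,t_r)]:
  apply exp(-iLt0), then for each step the search operator exp(-i theta_j |m><m|)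
  followed by exp(-iLt_j). The number of search-operator calls is the length of the list.\<close>
fun run_alg :: "nat \<Rightarrow> nat \<Rightarrow> nat set \<Rightarrow> (real \<times> real) list \<Rightarrow> (nat set \<Rightarrow> complex) \<Rightarrow> (nat set \<Rightarrow> complex)" where
  "run_alg n k m [] x = x"
| "run_alg n k m ((\<theta>, t) # rest) x =
     run_alg n k m rest (mapply (johnson_vertices n k) (walk_op n k t)
        (mapply (johnson_vertices n k) (search_op n k m \<theta>) x))"

definition final_state :: "nat \<Rightarrow> nat \<Rightarrow> nat set \<Rightarrow> real \<Rightarrow> (real \<times> real) list \<Rightarrow> nat set \<Rightarrow> complex" where
  "final_state n k m t0 steps =
     run_alg n k m steps (mapply (johnson_vertices n k) (walk_op n k t0) (unif_state n k))"

end

theory Submission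
  imports Defs
begin

text \<open>The algorithm is built in reverse, driving \<open>|m\<rangle>\<close> to the uniform state; inverting every parameter
  turns it around. Decompose \<open>|m\<rangle>\<close> into eigenvectors of the Laplacian. Its eigenvalues are the
  integers \<open>j(n+1-j)\<close>, so for a state supported on eigenvalues divisible by \<open>2\<^sup>a\<close> the walk at time
  \<open>\<pi>/2\<^sup>a\<close> is a reflection separating those divisible by \<open>2\<^sup>a\<^sup>+\<^sup>1\<close>. Conjugating the search operator by the
  circuit built so far gives phase reflections about the current state, so exact amplitude
  amplification in a plane projects the state onto the even part; if that part has weight \<open>q\<close>, the number
  of calls grows by a factor of at most \<open>9 / sqrt q\<close>. After at most \<open>k\<close> proper splits only the eigenvalue
  \<open>0\<close>, that is the uniform state, is left, and the factors telescope to \<open>9\<^sup>k sqrt N\<close>.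

  This bound needs \<open>q \<le> 1/4\<close> or \<open>q \<ge> 3/4\<close>, which holds for large \<open>n\<close> because the weights of the
  eigenvalues grow geometrically with \<open>j\<close>. For the finitely many remaining \<open>n\<close> any exact algorithm
  suffices; only \<open>q = 1/2\<close> obstructs amplification, and there the state is first perturbed.\<close>

text \<open>The reverse direction matters because the search operator reflects about |m>, the start
  of the reversed run, so every later state can be reflected about in turn. A reflection about a
  state reached with T calls costs 2T+1 of them, and j Grover iterations followed by two corrective
  reflections turn 2T+1 into exactly (2j+5)(2T+1); this is why bounds are carried for 2T+1 rather
  than T. Plain Grover rotation misses the target; exactness comes from two free phases, one found
  by the intermediate value theorem, the other solved for, and the four cosines below are the sign
  condition for the first. The angle is \<phi> = arcsin (sqrt q). Close to pi/4 a suitable j still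
  exists, but the one constructed grows without bound, so weights near 1/2 must be kept away from
  large n. The marked vertex drops out of the parameters because the projections of |m> to the
  eigenspaces have lengths independent of m.\<close>

subsection \<open>The number of Grover iterations\<close>

text \<open>With three of the four angles below \<open>\<pi>/2\<close> and the last one beyond it, exactly one of the
  cosines is nonpositive.\<close>
lemma grover_iterations_small_angle:
  fixes \<phi> :: real
  assumes "0 < \<phi>" "\<phi> \<le> pi / 6"
  obtains j :: nat where "j \<ge> 1"
    "cos (real (2*j+3) * \<phi>) * cos (real (2*j+1) * \<phi>)
      * (cos ((real (2*j) - 1) * \<phi>) * cos ((real (2*j) - 3) * \<phi>)) \<le> 0"
    "real (2*j+5) \<le> 9 / sin \<phi>"
proof -
  \<comment> \<open>\<open>x\<close> solves (2x+1)\<phi> = pi/2, so its floor is the last j whose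
    angle does not pass pi/2; \<phi> \<le> pi/6 makes it at least 1.\<close>
  define x where "x = pi / (4 * \<phi>) - 1 / 2"
  define j where "j = nat \<lfloor>x\<rfloor>"
  have "x \<ge> 1" using assms by (simp add: x_def field_simps)
  then have j1: "j \<ge> 1" and jle: "real j \<le> x" and jgt: "x < real j + 1"
    unfolding j_def by (simp_all add: le_nat_floor)
  have a: "real (2*j+1) * \<phi> \<le> pi / 2" using jle assms unfolding x_def by (simp add: field_simps)
  have b: "real (2*j+3) * \<phi> \<ge> pi / 2" using jgt assms unfolding x_def by (simp add: field_simps)
  have c: "cos (real (2*j+3) * \<phi>) \<le> 0"
  proof -
    have "real (2*j+3) * \<phi> = real (2*j+1) * \<phi> + 2 * \<phi>" by (simp add: algebra_simps)
    then have "real (2*j+3) * \<phi> \<le> pi" using a assms by linarith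
    then show ?thesis using b cos_monotone_0_pi_le[of "pi/2" "real (2*j+3) * \<phi>"] by simp
  qed
  have d: "cos (real (2*j+1) * \<phi>) \<ge> 0" by (rule cos_ge_zero) (use a assms in \<open>auto intro: order_trans[of _ 0]\<close>)
  have e: "cos ((real (2*j) - 1) * \<phi>) \<ge> 0"
  proof (rule cos_ge_zero)
    have "0 \<le> (real (2*j) - 1) * \<phi>" by (rule mult_nonneg_nonneg) (use j1 assms in auto)
    then show "- (pi/2) \<le> (real (2*j) - 1) * \<phi>" using pi_gt_zero by linarith
    show "(real (2*j) - 1) * \<phi> \<le> pi / 2" using a assms by (simp add: algebra_simps)
  qed
  have f: "cos ((real (2*j) - 3) * \<phi>) \<ge> 0"
  proof (rule cos_ge_zero)
    have "(real (2*j) - 3) * \<phi> \<ge> (-1) * \<phi>" by (rule mult_right_mono) (use j1 assms in auto)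
    then show "- (pi/2) \<le> (real (2*j) - 3) * \<phi>" using assms pi_gt_zero by linarith
    show "(real (2*j) - 3) * \<phi> \<le> pi / 2" using a assms by (simp add: algebra_simps)
  qed
  have "real (2*j+5) \<le> 9 / sin \<phi>"
  proof -
    have s: "0 < sin \<phi>" by (rule sin_gt_zero) (use assms in auto)
    have sl: "sin \<phi> \<le> \<phi>" by (rule sin_x_le_x) (use assms in auto)
    have s2: "sin \<phi> \<le> 1 / 2"
      using sin_monotone_2pi_le[of \<phi> "pi/6"] assms by (simp add: sin_30)
    have "real (2*j+1) * sin \<phi> \<le> real (2*j+1) * \<phi>" by (rule mult_left_mono) (use sl in auto)
    then have "real (2*j+5) * sin \<phi> \<le> pi / 2 + 2" using a s2 by (simp add: algebra_simps)
    also have "\<dots> \<le> 9" using pi_less_4 by linarith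
    finally show ?thesis using s by (simp add: field_simps)
  qed
  moreover have "cos (real (2*j+3) * \<phi>) * cos (real (2*j+1) * \<phi>)
      * (cos ((real (2*j) - 1) * \<phi>) * cos ((real (2*j) - 3) * \<phi>)) \<le> 0"
    using c d e f by (meson mult_nonneg_nonneg mult_nonpos_nonneg)
  ultimately show ?thesis using that j1 by blast
qed

text \<open>One iteration always serves: 3\<phi> lies in [pi, 3pi/2], 5\<phi> in [5pi/3, 5pi/2], and
  for j = 1 the other two cosines are equal. The factor 2j+5 is then 7, which 9 covers as sin \<phi>
  \<le> 1.\<close>

lemma grover_iterations_large_angle:
  fixes \<phi> :: real
  assumes "pi / 3 \<le> \<phi>" "\<phi> \<le> pi / 2"
  obtains j :: nat where "j \<ge> 1"
    "cos (real (2*j+3) * \<phi>) * cos (real (2*j+1) * \<phi>)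
      * (cos ((real (2*j) - 1) * \<phi>) * cos ((real (2*j) - 3) * \<phi>)) \<le> 0"
    "real (2*j+5) \<le> 9 / sin \<phi>"
proof -
  have a: "cos (3 * \<phi>) \<le> 0"
  proof -
    have "cos (3 * \<phi> - pi) \<ge> 0" by (rule cos_ge_zero) (use assms in auto)
    then show ?thesis by simp
  qed
  have b: "cos (5 * \<phi>) \<ge> 0"
  proof -
    have "cos (5 * \<phi> - 2 * pi) \<ge> 0" by (rule cos_ge_zero) (use assms in auto)
    then show ?thesis by (simp add: cos_diff)
  qed
  have s: "0 < sin \<phi>" by (rule sin_gt_zero) (use assms pi_gt_zero in linarith)+
  have "7 * sin \<phi> \<le> 9" using sin_le_one[of \<phi>] by linarith
  then have c: "7 \<le> 9 / sin \<phi>" using s by (simp add: field_simps)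
  have "cos (5 * \<phi>) * cos (3 * \<phi>) * (cos \<phi> * cos \<phi>) \<le> 0"
    using mult_nonneg_nonpos[OF b a] by (simp add: mult_nonpos_nonneg)
  then show ?thesis using that[of 1] c by simp
qed

text \<open>Writing \<open>\<phi> = \<pi>/4 - \<delta>\<close>, the sign condition says that \<open>cos (4 j \<phi>) = \<plusminus> cos (4 j \<delta>)\<close> lies
  between \<open>sin (6 \<delta>)\<close> and \<open>- sin (2 \<delta>)\<close>; take \<open>4 j \<delta>\<close> nearest to \<open>\<plusminus> \<pi>/2\<close>.\<close>
lemma grover_iterations_middle_angle:
  fixes \<phi> :: real
  assumes "pi / 6 < \<phi>" "\<phi> < pi / 3" "\<phi> \<noteq> pi / 4"
  obtains j :: nat where "j \<ge> 1"
    "cos (real (2*j+3) * \<phi>) * cos (real (2*j+1) * \<phi>)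
      * (cos ((real (2*j) - 1) * \<phi>) * cos ((real (2*j) - 3) * \<phi>)) \<le> 0"
proof -
  define \<delta> where "\<delta> = pi / 4 - \<phi>"
  define d where "d = \<bar>\<delta>\<bar>"
  have d: "0 < d" "d < pi / 12" using assms unfolding d_def \<delta>_def by linarith+
  \<comment> \<open>The floor of \<open>x\<close> rounds pi/(8d) to a nearest integer; the rounding
    error 1/2 becomes 2d in \<open>\<epsilon>\<close>, and d < pi/12 keeps j positive.\<close>
  define x where "x = pi / (8 * d) + 1 / 2"
  define j where "j = nat \<lfloor>x\<rfloor>"
  have x1: "x \<ge> 1" using d by (simp add: x_def field_simps)
  then have j1: "j \<ge> 1" and jle: "real j \<le> x" and jgt: "x < real j + 1"
    unfolding j_def by (simp_all add: le_nat_floor)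
  define \<epsilon> where "\<epsilon> = pi / 2 - 4 * real j * d"
  have e: "- (2 * d) \<le> \<epsilon>" "\<epsilon> \<le> 2 * d" using jle jgt d unfolding x_def \<epsilon>_def
    by (simp_all add: field_simps)
  have "cos (4 * real j * d) = sin \<epsilon>" by (simp add: \<epsilon>_def sin_diff)
  moreover have "sin \<epsilon> \<le> sin (2 * d)" by (rule sin_monotone_2pi_le) (use e d in auto)
  moreover have "sin (- (2 * d)) \<le> sin \<epsilon>" by (rule sin_monotone_2pi_le) (use e d in auto)
  ultimately have cd: "\<bar>cos (4 * real j * d)\<bar> \<le> sin (2 * d)" by (simp add: abs_le_iff)
  have "cos (4 * real j * \<delta>) = cos (4 * real j * d)" unfolding d_def by (simp add: abs_if)
  moreover have "\<bar>cos (4 * real j * \<phi>)\<bar> = \<bar>cos (4 * real j * \<delta>)\<bar>"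
  proof -
    have "4 * real j * \<phi> = real j * pi - 4 * real j * \<delta>" by (simp add: \<delta>_def algebra_simps)
    then have "cos (4 * real j * \<phi>) = cos (real j * pi) * cos (4 * real j * \<delta>)"
      by (simp add: cos_diff)
    then show ?thesis by (simp add: abs_mult)
  qed
  ultimately have c: "\<bar>cos (4 * real j * \<phi>)\<bar> \<le> sin (2 * d)" using cd by simp
  have s26: "sin (2 * d) \<le> sin (6 * d)" by (rule sin_monotone_2pi_le) (use d in auto)
  have c2: "cos (2 * \<phi>) = sin (2 * \<delta>)" by (simp add: \<delta>_def sin_diff)
  have "6 * \<phi> = 3 * pi / 2 - 6 * \<delta>" by (simp add: \<delta>_def algebra_simps)
  then have "cos (6 * \<phi>) = cos (3 * pi / 2 - 6 * \<delta>)" by simp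
  also have "\<dots> = - sin (6 * \<delta>)" using cos_3over2_pi sin_3over2_pi by (simp only: cos_diff) simp
  finally have c6: "cos (6 * \<phi>) = - sin (6 * \<delta>)" .
  have prod: "(cos (4 * real j * \<phi>) + cos (6 * \<phi>)) * (cos (4 * real j * \<phi>) + cos (2 * \<phi>)) \<le> 0"
  proof (cases "\<delta> \<ge> 0")
    case True
    then have "d = \<delta>" by (simp add: d_def)
    then have "cos (4 * real j * \<phi>) + cos (6 * \<phi>) \<le> 0" "cos (4 * real j * \<phi>) + cos (2 * \<phi>) \<ge> 0"
      using c s26 unfolding c2 c6 by auto
    then show ?thesis by (rule mult_nonpos_nonneg)
  next
    case False
    then have "\<delta> = - d" by (simp add: d_def)
    then have "cos (4 * real j * \<phi>) + cos (6 * \<phi>) \<ge> 0" "cos (4 * real j * \<phi>) + cos (2 * \<phi>) \<le> 0"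
      using c s26 unfolding c2 c6 by auto
    then show ?thesis by (rule mult_nonneg_nonpos)
  qed
  \<comment> \<open>Pairing the outer two cosines and the inner two makes both products share the
    term cos (4j\<phi>).\<close>
  have p1: "cos (real (2*j+3) * \<phi>) * cos ((real (2*j) - 3) * \<phi>) = (cos (4 * real j * \<phi>) + cos (6 * \<phi>)) / 2"
    unfolding cos_times_cos by (simp add: algebra_simps)
  have p2: "cos (real (2*j+1) * \<phi>) * cos ((real (2*j) - 1) * \<phi>) = (cos (4 * real j * \<phi>) + cos (2 * \<phi>)) / 2"
    unfolding cos_times_cos by (simp add: algebra_simps)
  have "cos (real (2*j+3) * \<phi>) * cos (real (2*j+1) * \<phi>)
      * (cos ((real (2*j) - 1) * \<phi>) * cos ((real (2*j) - 3) * \<phi>))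
     = (cos (real (2*j+3) * \<phi>) * cos ((real (2*j) - 3) * \<phi>)) * (cos (real (2*j+1) * \<phi>) * cos ((real (2*j) - 1) * \<phi>))"
    by (simp only: mult_ac)
  also have "\<dots> \<le> 0" unfolding p1 p2 using prod by simp
  finally show ?thesis using that j1 by blast
qed

subsection \<open>Search circuits in the spectral picture\<close>

lemma unit_cnj_mult: "cmod e = 1 \<Longrightarrow> cnj e * e = 1"
  using complex_norm_square[of e] by (simp add: mult.commute)

text \<open>Coordinates free of the marked vertex: a function a stands for the state \<Sum> a(\<mu>)
  P(\<mu>)|m>, with P(\<mu>) the projection to the eigenspace of \<mu>, and p(\<mu>) is the squared
  length of P(\<mu>)|m>. So \<open>ip\<close> is the inner product of states and \<open>one\<close>
  is |m> itself.\<close>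

locale spectral_search =
  fixes Lam :: "nat set" and p :: "nat \<Rightarrow> real"
  assumes fin: "finite Lam" and p_pos: "\<And>\<mu>. \<mu> \<in> Lam \<Longrightarrow> p \<mu> > 0"
    and p_sum: "sum p Lam = 1" and zero_in: "0 \<in> Lam"
begin

definition ip :: "(nat \<Rightarrow> complex) \<Rightarrow> (nat \<Rightarrow> complex) \<Rightarrow> complex" where
  "ip a b = (\<Sum>\<mu>\<in>Lam. of_real (p \<mu>) * cnj (a \<mu>) * b \<mu>)"

definition one :: "nat \<Rightarrow> complex" where
  "one \<mu> = (if \<mu> \<in> Lam then 1 else 0)"

definition walk :: "real \<Rightarrow> (nat \<Rightarrow> complex) \<Rightarrow> nat \<Rightarrow> complex" where
  "walk t a \<mu> = cis (- real \<mu> * t) * a \<mu>"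

text \<open>For a unit vector x this is exp(-i\<theta>|x><x|); the search operator is the case x =
  \<open>one\<close>.\<close>

definition refl :: "(nat \<Rightarrow> complex) \<Rightarrow> real \<Rightarrow> (nat \<Rightarrow> complex) \<Rightarrow> nat \<Rightarrow> complex" where
  "refl x \<theta> a \<mu> = a \<mu> + (cis (- \<theta>) - 1) * ip x a * x \<mu>"

text \<open>The index counts search operators, and walks are free. A walk stands at either end, so
  that composing two circuits merges the adjacent walks and keeps the alternating shape of the
  algorithm.\<close>

inductive circuit :: "nat \<Rightarrow> ((nat \<Rightarrow> complex) \<Rightarrow> nat \<Rightarrow> complex) \<Rightarrow> bool" where
  circuit_walk: "circuit 0 (walk t)"
| circuit_step: "circuit T U \<Longrightarrow> circuit (Suc T) (\<lambda>a. walk t (refl one \<theta> (U a)))"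

lemma walk_walk: "walk s (walk t a) = walk (s + t) a"
  by (rule ext) (simp add: walk_def cis_mult algebra_simps flip: mult.assoc)

lemma walk_0 [simp]: "walk 0 a = a"
  by (rule ext) (simp add: walk_def)

lemma ip_walk: "ip (walk t a) (walk t b) = ip a b"
  unfolding ip_def walk_def
proof (rule sum.cong[OF HOL.refl])
  fix \<mu>
  have "cnj (cis (- real \<mu> * t)) * cis (- real \<mu> * t) = 1"
    by (simp add: cis_cnj cis_mult)
  then show "complex_of_real (p \<mu>) * cnj (cis (- real \<mu> * t) * a \<mu>) * (cis (- real \<mu> * t) * b \<mu>)
      = complex_of_real (p \<mu>) * cnj (a \<mu>) * b \<mu>"
    by (simp add: mult_ac)
qed

lemma ip_add_right: "ip x (\<lambda>\<mu>. a \<mu> + b \<mu>) = ip x a + ip x b"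
  by (simp add: ip_def sum.distrib algebra_simps)

lemma ip_scale_right: "ip x (\<lambda>\<mu>. c * a \<mu>) = c * ip x a"
  by (simp add: ip_def sum_distrib_left algebra_simps)

lemma ip_cnj: "cnj (ip a b) = ip b a"
  by (simp add: ip_def algebra_simps)

lemma ip_add_left: "ip (\<lambda>\<mu>. a \<mu> + b \<mu>) x = ip a x + ip b x"
  by (simp add: ip_def sum.distrib algebra_simps)

lemma ip_scale_left: "ip (\<lambda>\<mu>. c * a \<mu>) x = cnj c * ip a x"
  by (simp add: ip_def sum_distrib_left algebra_simps)

lemma ip_self: "ip a a = of_real (\<Sum>\<mu>\<in>Lam. p \<mu> * (cmod (a \<mu>))\<^sup>2)"
  unfolding ip_def of_real_sum
  by (rule sum.cong[OF HOL.refl]) (simp only: of_real_mult complex_norm_square mult_ac)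

lemma ip_one: "ip one one = 1"
proof -
  have "(\<Sum>\<mu>\<in>Lam. p \<mu> * (cmod (one \<mu>))\<^sup>2) = (\<Sum>\<mu>\<in>Lam. p \<mu>)"
    by (rule sum.cong) (auto simp: one_def)
  then show ?thesis by (simp add: ip_self p_sum)
qed

lemma refl_eq: "refl x \<theta> a = (\<lambda>\<mu>. a \<mu> + (cis (- \<theta>) - 1) * ip x a * x \<mu>)"
  by (rule ext) (simp add: refl_def)

lemma refl_inverse:
  assumes "ip x x = 1"
  shows "refl x (- \<theta>) (refl x \<theta> a) = a"
proof (rule ext)
  fix \<mu>
  have i: "ip x (refl x \<theta> a) = cis (- \<theta>) * ip x a"
    unfolding refl_eq ip_add_right ip_scale_right assms by (simp add: algebra_simps)
  have c: "cis \<theta> * cis (- \<theta>) = 1" by (simp add: cis_mult)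
  have "refl x (- \<theta>) (refl x \<theta> a) \<mu>
      = a \<mu> + (cis (- \<theta>) - 1) * ip x a * x \<mu> + (cis \<theta> * cis (-\<theta>) - cis (- \<theta>)) * (ip x a * x \<mu>)"
    unfolding refl_def[of x "-\<theta>"] i by (simp add: refl_def algebra_simps)
  also have "\<dots> = a \<mu>" unfolding c by (simp add: algebra_simps)
  finally show "refl x (- \<theta>) (refl x \<theta> a) \<mu> = a \<mu>" .
qed

lemma ip_refl:
  assumes "ip x x = 1"
  shows "ip (refl x \<theta> a) (refl x \<theta> b) = ip a b"
proof -
  define c where "c = cis (- \<theta>) - 1"
  have "cis \<theta> * cis (- \<theta>) = 1" by (simp add: cis_mult)
  then have c: "cnj c + c + cnj c * c = 0" by (simp add: c_def cis_cnj algebra_simps)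
  have "ip (refl x \<theta> a) (refl x \<theta> b)
      = ip a b + c * ip x b * ip a x + cnj (c * ip x a) * (ip x b + c * ip x b)"
    unfolding refl_eq ip_add_right ip_scale_right ip_add_left ip_scale_left assms c_def[symmetric]
    by (simp add: algebra_simps)
  also have "\<dots> = ip a b + (cnj c + c + cnj c * c) * ip a x * ip x b"
    by (simp add: ip_cnj algebra_simps)
  finally show ?thesis by (simp add: c)
qed

lemma circuit_refl: "circuit (Suc 0) (refl one \<theta>)"
  using circuit_step[OF circuit_walk[of 0], of 0 \<theta>] by (simp add: eta_contract_eq)

lemma circuit_comp:
  assumes "circuit S U" "circuit T V"
  shows "circuit (S + T) (\<lambda>a. U (V a))"
  using assms(1)
proof induction
  case (circuit_walk t)
  from assms(2) show ?case
  proof cases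
    case (circuit_walk s)
    have "(\<lambda>a. walk t (V a)) = walk (t + s)" by (rule ext) (simp add: circuit_walk walk_walk)
    then show ?thesis using circuit.circuit_walk circuit_walk by simp
  next
    case (circuit_step T' W s \<theta>)
    then show ?thesis using circuit.circuit_step[of T' W "t + s" \<theta>] by (simp add: walk_walk)
  qed
next
  case (circuit_step S U t \<theta>)
  then show ?case using circuit.circuit_step[of "S + T" "\<lambda>a. U (V a)"] by simp
qed

lemma circuit_inverse:
  assumes "circuit T U"
  shows "\<exists>V. circuit T V \<and> (\<forall>a. V (U a) = a) \<and> (\<forall>a. U (V a) = a)"
  using assms
proof induction
  case (circuit_walk t)
  show ?case using circuit.circuit_walk[of "- t"]
    by (intro exI[of _ "walk (- t)"]) (simp add: walk_walk)
next
  case (circuit_step T U t \<theta>)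
  then obtain V where V: "circuit T V" "\<And>a. V (U a) = a" "\<And>a. U (V a) = a" by auto
  let ?W = "\<lambda>a. V (refl one (- \<theta>) (walk (- t) a))"
  have "circuit (T + (Suc 0 + 0)) ?W"
    by (rule circuit_comp[OF V(1) circuit_comp[OF circuit_refl circuit.circuit_walk]])
  moreover have "refl one \<theta> (refl one (- \<theta>) b) = b" for b
    using refl_inverse[OF ip_one, of "- \<theta>"] by simp
  ultimately show ?case
    by (intro exI[of _ ?W]) (simp add: V walk_walk refl_inverse[OF ip_one])
qed

lemma circuit_ip:
  assumes "circuit T U"
  shows "ip (U a) (U b) = ip a b"
  using assms by induction (simp_all add: ip_walk ip_refl[OF ip_one])

lemma circuit_linear:
  assumes "circuit T U"
  shows "U (\<lambda>\<mu>. a \<mu> + c * b \<mu>) = (\<lambda>\<mu>. U a \<mu> + c * U b \<mu>)"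
  using assms
proof (induction)
  case (circuit_walk t)
  show ?case by (rule ext) (simp add: walk_def algebra_simps)
next
  case (circuit_step T U t \<theta>)
  show ?case unfolding circuit_step.IH
    by (rule ext) (simp add: walk_def refl_def ip_add_right ip_scale_right algebra_simps)
qed

text \<open>A global phase is tolerated because the reflections about x and about e x coincide when
  |e| = 1.\<close>

definition reach :: "nat \<Rightarrow> (nat \<Rightarrow> complex) \<Rightarrow> bool" where
  "reach T x \<longleftrightarrow> (\<exists>U e. circuit T U \<and> cmod e = 1 \<and> U one = (\<lambda>\<mu>. e * x \<mu>))"

lemma reach_one: "reach 0 one"
  unfolding reach_def using circuit_walk[of 0] by (intro exI[of _ "walk 0"] exI[of _ 1]) simp

lemma circuit_scale:
  assumes "circuit T U"
  shows "U (\<lambda>\<mu>. c * b \<mu>) = (\<lambda>\<mu>. c * U b \<mu>)"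
proof -
  have "U (\<lambda>_. 0) = (\<lambda>_. 0)"
    using assms by induction (simp_all add: walk_def refl_def ip_def fun_eq_iff)
  then show ?thesis using circuit_linear[OF assms, of "\<lambda>_. 0" c b] by simp
qed

lemma reach_circuit:
  assumes "reach T x" "circuit S U"
  shows "reach (S + T) (U x)"
proof -
  from assms(1) obtain V e where V: "circuit T V" "cmod e = 1" "V one = (\<lambda>\<mu>. e * x \<mu>)"
    by (auto simp: reach_def)
  then show ?thesis unfolding reach_def
    by (intro exI[of _ "\<lambda>a. U (V a)"] exI[of _ e])
       (simp add: circuit_comp[OF assms(2)] circuit_scale[OF assms(2)])
qed

lemma reach_phase:
  assumes "reach T x" "\<And>\<mu>. x \<mu> = e * y \<mu>" "cmod e = 1"
  shows "reach T y"
proof -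
  from assms(1) obtain V e' where V: "circuit T V" "cmod e' = 1" "V one = (\<lambda>\<mu>. e' * x \<mu>)"
    by (auto simp: reach_def)
  then show ?thesis unfolding reach_def
    by (intro exI[of _ V] exI[of _ "e' * e"]) (simp add: assms norm_mult mult.assoc)
qed

lemma reach_norm:
  assumes "reach T x"
  shows "ip x x = 1"
proof -
  from assms obtain V e where V: "circuit T V" "cmod e = 1" "V one = (\<lambda>\<mu>. e * x \<mu>)"
    by (auto simp: reach_def)
  have "cnj e * e = 1" using V(2) by (rule unit_cnj_mult)
  moreover have "ip (\<lambda>\<mu>. e * x \<mu>) (\<lambda>\<mu>. e * x \<mu>) = cnj e * e * ip x x"
    by (simp add: ip_scale_left ip_scale_right)
  ultimately show ?thesis using circuit_ip[OF V(1), of one one] V(3) ip_one by simp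
qed

text \<open>Conjugating the search operator by a circuit reaching \<open>x\<close> gives the phase reflection
  about \<open>x\<close>.\<close>
lemma circuit_refl_reach:
  assumes "reach T x"
  shows "circuit (2 * T + 1) (refl x \<theta>)"
proof -
  from assms obtain U e where U: "circuit T U" "cmod e = 1" "U one = (\<lambda>\<mu>. e * x \<mu>)"
    by (auto simp: reach_def)
  obtain V where V: "circuit T V" "\<And>a. V (U a) = a" "\<And>a. U (V a) = a"
    using circuit_inverse[OF U(1)] by auto
  have e: "cnj e * e = 1" using U(2) by (rule unit_cnj_mult)
  have "U (refl one \<theta> (V a)) = refl x \<theta> a" for a
  proof -
    have "ip one (V a) = ip (U one) a" using circuit_ip[OF U(1), of one "V a"] V by simp
    then have i: "ip one (V a) = cnj e * ip x a" by (simp add: U ip_scale_left)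
    have "U (refl one \<theta> (V a)) = (\<lambda>\<mu>. a \<mu> + (cis (- \<theta>) - 1) * (cnj e * ip x a) * (e * x \<mu>))"
      unfolding refl_eq i circuit_linear[OF U(1)] V U(3) ..
    also have "\<dots> = (\<lambda>\<mu>. a \<mu> + (cnj e * e) * ((cis (- \<theta>) - 1) * ip x a * x \<mu>))"
      by (simp add: mult_ac)
    finally show ?thesis unfolding e refl_eq by simp
  qed
  then have "(\<lambda>a. U (refl one \<theta> (V a))) = refl x \<theta>" by (rule ext)
  moreover have "circuit (T + (Suc 0 + T)) (\<lambda>a. U (refl one \<theta> (V a)))"
    by (rule circuit_comp[OF U(1) circuit_comp[OF circuit_refl V(1)]])
  ultimately show ?thesis by (simp add: mult_2)
qed

end

section \<open>Exact amplitude amplification in a plane\<close>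

lemma complex_unit_minus_one:
  assumes "cmod (1 + d) = 1"
  obtains \<theta> :: real where "d = cis (- \<theta>) - 1"
proof -
  have "1 + d = cis (Arg (1 + d))"
    using rcis_cmod_Arg[of "1 + d"] by (simp add: assms rcis_def)
  then have "d = cis (- (- Arg (1 + d))) - 1" by (simp add: algebra_simps)
  then show ?thesis by (rule that)
qed

text \<open>The last phase reflection can clear the \<open>v\<close>-component exactly when the overlap
  \<open>\<bar>\<langle>x|y\<rangle>\<bar>\<close> already equals \<open>\<bar>\<langle>x|u\<rangle>\<bar> = sin \<phi>\<close>.\<close>
lemma final_phase:
  fixes \<phi> :: real and \<alpha> \<beta> :: complex
  assumes \<phi>: "0 < \<phi>" "\<phi> < pi / 2" and norm: "(cmod \<alpha>)\<^sup>2 + (cmod \<beta>)\<^sup>2 = 1"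
    and overlap: "cmod (of_real (sin \<phi>) * \<alpha> + of_real (cos \<phi>) * \<beta>) = sin \<phi>"
  obtains \<theta> :: real where
    "\<beta> + (cis (- \<theta>) - 1) * (of_real (sin \<phi>) * \<alpha> + of_real (cos \<phi>) * \<beta>) * of_real (cos \<phi>) = 0"
proof -
  define s c where "s = sin \<phi>" and "c = cos \<phi>"
  have s: "s > 0" and c: "c > 0" using \<phi> by (auto simp: s_def c_def sin_gt_zero cos_gt_zero)
  have sc: "s\<^sup>2 + c\<^sup>2 = 1" by (simp add: s_def c_def)
  define w where "w = of_real s * \<alpha> + of_real c * \<beta>"
  \<comment> \<open>\<open>w\<close> and \<open>w'\<close> are the coordinates of the state along x
    and along its orthogonal direction in the plane; the overlap hypothesis thus fixes both
    moduli.\<close>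
  define w' where "w' = of_real c * \<alpha> - of_real s * \<beta>"
  have w: "cmod w = s" using overlap by (simp add: w_def s_def c_def)
  have "(cmod w)\<^sup>2 + (cmod w')\<^sup>2 = (s\<^sup>2 + c\<^sup>2) * ((cmod \<alpha>)\<^sup>2 + (cmod \<beta>)\<^sup>2)"
    unfolding cmod_power2 w_def w'_def by (simp add: power2_eq_square algebra_simps)
  then have "(cmod w')\<^sup>2 = c\<^sup>2" using norm sc w by simp
  then have w': "cmod w' = c" using c by (simp add: power2_eq_iff_nonneg)
  have wnz: "w \<noteq> 0" using w s by auto
  \<comment> \<open>\<open>d\<close> is forced by the requirement that the
    \<open>v\<close>-component vanish. It has the form cis (-\<theta>) - 1 precisely if |1 + d| = 1,
    and c w (1 + d) = s w' shows this.\<close>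
  define d where "d = - \<beta> / (of_real c * w)"
  have "of_real c * w * (1 + d) = of_real c * w - \<beta>" using wnz c by (simp add: d_def field_simps)
  also have "\<dots> = of_real (s * c) * \<alpha> + (of_real (c\<^sup>2) - 1) * \<beta>"
    by (simp add: w_def algebra_simps power2_eq_square)
  also have "of_real (c\<^sup>2) - 1 = - (of_real (s\<^sup>2) :: complex)"
    using sc by (metis add_diff_cancel_right' minus_diff_eq of_real_1 of_real_diff)
  also have "of_real (s * c) * \<alpha> + - of_real (s\<^sup>2) * \<beta> = of_real s * w'"
    by (simp add: w'_def algebra_simps power2_eq_square)
  finally have "c * cmod w * cmod (1 + d) = s * cmod w'"
    using c s by (metis abs_of_pos norm_mult norm_of_real)
  then have "cmod (1 + d) = 1" using w w' s c by simp
  then obtain \<theta> where \<theta>: "d = cis (- \<theta>) - 1" by (rule complex_unit_minus_one)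
  have "\<beta> + d * w * of_real c = 0" using wnz c by (simp add: d_def field_simps)
  then show ?thesis using that[of \<theta>] by (simp add: \<theta> w_def s_def c_def)
qed

text \<open>Replacing one Grover reflection by a phase reflection moves the overlap continuously between
  its values at phases \<open>0\<close> and \<open>\<pi>\<close>, whose signs relative to \<open>sin \<phi>\<close> differ.\<close>
lemma overlap_phase:
  fixes \<phi> \<alpha> :: real
  assumes "cos (\<alpha> + 2*\<phi>) * cos \<alpha> * (cos (\<alpha> - 2*\<phi>) * cos (\<alpha> - 4*\<phi>)) \<le> 0" "sin \<phi> \<ge> 0"
  obtains \<theta> :: real where
    "cmod (of_real (- cos (\<alpha> + \<phi>)) - (cis (- \<theta>) - 1) * of_real (cos (\<alpha> - \<phi>) * cos (2*\<phi>))) = sin \<phi>"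
proof -
  define f where "f \<theta> = (cmod (of_real (- cos (\<alpha> + \<phi>))
    - (cis (- \<theta>) - 1) * of_real (cos (\<alpha> - \<phi>) * cos (2*\<phi>))))\<^sup>2 - (sin \<phi>)\<^sup>2" for \<theta> :: real
  \<comment> \<open>Turns the comparison of an overlap with sin \<phi> into a product of two
    cosines, at each end of the interval of phases.\<close>
  have sq: "(cos a)\<^sup>2 - (sin b)\<^sup>2 = cos (a + b) * cos (a - b)" for a b :: real
  proof -
    have "cos (a + b) * cos (a - b) = (cos a)\<^sup>2 * (cos b)\<^sup>2 - (sin a)\<^sup>2 * (sin b)\<^sup>2"
      by (simp add: cos_add cos_diff algebra_simps power2_eq_square)
    also have "\<dots> = (cos a)\<^sup>2 - (sin b)\<^sup>2"
      unfolding cos_squared_eq[of b] sin_squared_eq[of a] by (simp add: algebra_simps)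
    finally show ?thesis by simp
  qed
  have "f 0 = (cos (\<alpha> + \<phi>))\<^sup>2 - (sin \<phi>)\<^sup>2" unfolding f_def by (simp flip: of_real_minus)
  also have "\<dots> = cos (\<alpha> + 2*\<phi>) * cos \<alpha>" unfolding sq by (simp add: algebra_simps)
  finally have f0: "f 0 = cos (\<alpha> + 2*\<phi>) * cos \<alpha>" .
  have "2 * (cos (\<alpha> - \<phi>) * cos (2*\<phi>)) = cos (\<alpha> - 3*\<phi>) + cos (\<alpha> + \<phi>)"
    unfolding cos_times_cos by (simp add: algebra_simps)
  then have e: "of_real (- cos (\<alpha> + \<phi>)) - (cis (- pi) - 1) * complex_of_real (cos (\<alpha> - \<phi>) * cos (2*\<phi>))
      = of_real (cos (\<alpha> - 3*\<phi>))"
    by (simp add: cis.ctr complex_eq_iff)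
  have "f pi = (cos (\<alpha> - 3*\<phi>))\<^sup>2 - (sin \<phi>)\<^sup>2" unfolding f_def e by simp
  also have "\<dots> = cos (\<alpha> - 2*\<phi>) * cos (\<alpha> - 4*\<phi>)" unfolding sq by (simp add: algebra_simps)
  finally have fpi: "f pi = cos (\<alpha> - 2*\<phi>) * cos (\<alpha> - 4*\<phi>)" .
  have "f 0 * f pi \<le> 0" using assms(1) unfolding f0 fpi by simp
  moreover have cont: "continuous_on {0..pi} f" unfolding f_def
    by (intro continuous_intros)
  ultimately have "\<exists>\<theta>. f \<theta> = 0"
    using IVT'[of f 0 0 pi, OF _ _ pi_ge_zero cont] IVT2'[of f pi 0 0, OF _ _ pi_ge_zero cont]
    unfolding mult_le_0_iff by blast
  then obtain \<theta> where "f \<theta> = 0" ..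
  then have "cmod (of_real (- cos (\<alpha> + \<phi>)) - (cis (- \<theta>) - 1) * of_real (cos (\<alpha> - \<phi>) * cos (2*\<phi>)))
      = sin \<phi>"
    unfolding f_def using assms(2) by (simp add: power2_eq_iff_nonneg)
  then show ?thesis by (rule that)
qed

context spectral_search
begin

text \<open>In the plane of u and v, the walk followed by the reflection of phase pi is a Grover
  rotation by 2\<phi>, so j rounds bring x to the angle (2j+1)\<phi>. A reflection of adjustable
  phase then gives the overlap required by \<open>final_phase\<close>, and one more clears v: j+2
  reflections of cost 2T+1 each, on top of the T calls for x.\<close>

lemma exact_amplification:
  fixes j :: nat and \<phi> :: real
  assumes reach: "reach T x" and \<phi>: "0 < \<phi>" "\<phi> < pi / 2" and j: "j \<ge> 1"
    and sgn: "cos (real (2*j+3) * \<phi>) * cos (real (2*j+1) * \<phi>)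
      * (cos ((real (2*j) - 1) * \<phi>) * cos ((real (2*j) - 3) * \<phi>)) \<le> 0"
    and x: "x = (\<lambda>\<mu>. of_real (sin \<phi>) * u \<mu> + of_real (cos \<phi>) * v \<mu>)"
    and orth: "ip u u = 1" "ip v v = 1" "ip u v = 0"
    and split: "walk \<tau> u = u" "walk \<tau> v = (\<lambda>\<mu>. - v \<mu>)"
  shows "reach (T + (j + 2) * (2 * T + 1)) u"
proof -
  define vec where "vec \<alpha> \<beta> = (\<lambda>\<mu>. \<alpha> * u \<mu> + \<beta> * v \<mu>)" for \<alpha> \<beta>
  define s c where "s = complex_of_real (sin \<phi>)" and "c = complex_of_real (cos \<phi>)"
  have vu: "ip v u = 0" using orth(3) ip_cnj[of u v] by simp
  have ipv: "ip x (vec \<alpha> \<beta>) = s * \<alpha> + c * \<beta>" for \<alpha> \<beta>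
    unfolding x vec_def ip_add_right ip_scale_right ip_add_left ip_scale_left
    by (simp add: orth vu s_def c_def algebra_simps)
  have R: "refl x \<theta> (vec \<alpha> \<beta>) = vec (\<alpha> + (cis (- \<theta>) - 1) * (s * \<alpha> + c * \<beta>) * s)
      (\<beta> + (cis (- \<theta>) - 1) * (s * \<alpha> + c * \<beta>) * c)" for \<theta> \<alpha> \<beta>
    unfolding refl_eq ipv by (rule ext) (simp add: vec_def x s_def c_def algebra_simps)
  have Z: "walk \<tau> (vec \<alpha> \<beta>) = vec \<alpha> (- \<beta>)" for \<alpha> \<beta>
  proof (rule ext)
    fix \<mu>
    have "walk \<tau> (vec \<alpha> \<beta>) \<mu> = \<alpha> * walk \<tau> u \<mu> + \<beta> * walk \<tau> v \<mu>"
      by (simp add: walk_def vec_def algebra_simps)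
    then show "walk \<tau> (vec \<alpha> \<beta>) \<mu> = vec \<alpha> (- \<beta>) \<mu>" by (simp add: split vec_def)
  qed
  have normv: "(cmod \<alpha>)\<^sup>2 + (cmod \<beta>)\<^sup>2 = 1" if "reach S (vec \<alpha> \<beta>)" for S \<alpha> \<beta>
  proof -
    have "ip (vec \<alpha> \<beta>) (vec \<alpha> \<beta>) = \<alpha> * cnj \<alpha> + \<beta> * cnj \<beta>"
      unfolding vec_def ip_add_right ip_scale_right ip_add_left ip_scale_left
      by (simp add: orth vu algebra_simps)
    then have "complex_of_real ((cmod \<alpha>)\<^sup>2 + (cmod \<beta>)\<^sup>2) = 1"
      using reach_norm[OF that] by (simp only: of_real_add complex_norm_square)
    then show ?thesis by (metis of_real_eq_1_iff)
  qed
  have RZ: "reach (S + (2*T+1)) (refl x \<theta> (walk \<tau> y))" if "reach S y" for S y \<theta>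
    using reach_circuit[OF reach_circuit[OF that circuit_walk[of \<tau>]] circuit_refl_reach[OF reach, of \<theta>]]
    by (simp add: add.commute)
  have G: "reach (T + i * (2*T+1)) (vec (of_real (sin (real (2*i+1) * \<phi>))) (of_real (cos (real (2*i+1) * \<phi>))))" for i
  proof (induction i)
    case 0
    show ?case using reach by (simp add: vec_def x)
  next
    case (Suc i)
    define \<alpha> where "\<alpha> = real (2*i+1) * \<phi>"
    have a: "real (2 * Suc i + 1) * \<phi> = \<alpha> + 2 * \<phi>" by (simp add: \<alpha>_def algebra_simps)
    have e1: "sin \<alpha> + 2 * (cos (\<alpha> + \<phi>) * sin \<phi>) = sin (\<alpha> + 2*\<phi>)"
      unfolding cos_times_sin by (simp add: field_simps)
    have e2: "- cos \<alpha> + 2 * (cos (\<alpha> + \<phi>) * cos \<phi>) = cos (\<alpha> + 2*\<phi>)"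
      unfolding cos_times_cos by (simp add: field_simps)
    have e0: "s * of_real (sin \<alpha>) + c * (- of_real (cos \<alpha>)) = - complex_of_real (cos (\<alpha> + \<phi>))"
      by (simp add: s_def c_def cos_add algebra_simps)
    have cp: "cis (- pi) - 1 = -2" by (simp add: complex_eq_iff)
    have "refl x pi (walk \<tau> (vec (of_real (sin \<alpha>)) (of_real (cos \<alpha>))))
      = vec (of_real (sin \<alpha> + 2 * (cos (\<alpha> + \<phi>) * sin \<phi>))) (of_real (- cos \<alpha> + 2 * (cos (\<alpha> + \<phi>) * cos \<phi>)))"
      unfolding Z R e0 cp by (simp add: s_def c_def mult.assoc)
    then show ?case
      using RZ[OF Suc, of pi] unfolding a \<alpha>_def[symmetric] e1 e2 by (simp add: algebra_simps)
  qed
  define \<alpha> where "\<alpha> = real (2*j+1) * \<phi>"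
  have a: "real (2*j+3) * \<phi> = \<alpha> + 2*\<phi>" "(real (2*j) - 1) * \<phi> = \<alpha> - 2*\<phi>" "(real (2*j) - 3) * \<phi> = \<alpha> - 4*\<phi>"
    by (simp_all add: \<alpha>_def algebra_simps)
  have sp: "sin \<phi> > 0" using \<phi> by (simp add: sin_gt_zero)
  obtain \<theta> where \<theta>: "cmod (of_real (- cos (\<alpha> + \<phi>)) - (cis (- \<theta>) - 1) * of_real (cos (\<alpha> - \<phi>) * cos (2*\<phi>))) = sin \<phi>"
    by (rule overlap_phase[OF sgn[unfolded a \<alpha>_def[symmetric]] less_imp_le[OF sp]])
  \<comment> \<open>No walk precedes this reflection, so together with the last of the j iterations
    it acts as one reflection of phase pi + \<theta>: \<theta> = 0 keeps that iteration, \<theta> =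
    pi cancels its reflection.\<close>
  define A where "A = of_real (sin \<alpha>) + (cis (- \<theta>) - 1) * of_real (cos (\<alpha> - \<phi>)) * s"
  define B where "B = of_real (cos \<alpha>) + (cis (- \<theta>) - 1) * of_real (cos (\<alpha> - \<phi>)) * c"
  have e0: "s * of_real (sin \<alpha>) + c * (of_real (cos \<alpha>)) = complex_of_real (cos (\<alpha> - \<phi>))"
    by (simp add: s_def c_def cos_diff algebra_simps)
  have r1: "reach (T + (j+1) * (2*T+1)) (vec A B)"
    using reach_circuit[OF G[of j] circuit_refl_reach[OF reach, of \<theta>]]
    unfolding \<alpha>_def[symmetric] R e0 A_def[symmetric] B_def[symmetric] by (simp add: algebra_simps)
  have r2: "reach (T + (j+1) * (2*T+1)) (vec A (- B))"
    using reach_circuit[OF r1 circuit_walk[of \<tau>]] unfolding Z by simp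
  have "s * A + c * (- B) = of_real (- cos (\<alpha> + \<phi>)) - (cis (- \<theta>) - 1) * of_real (cos (\<alpha> - \<phi>) * cos (2*\<phi>))"
    unfolding A_def B_def s_def c_def cos_add cos_double by (simp add: algebra_simps power2_eq_square)
  then have ov: "cmod (of_real (sin \<phi>) * A + of_real (cos \<phi>) * (- B)) = sin \<phi>"
    using \<theta> by (simp only: s_def c_def)
  obtain \<theta>' where \<theta>': "- B + (cis (- \<theta>') - 1) * (s * A + c * (- B)) * c = 0"
    using final_phase[OF \<phi> normv[OF r2] ov] unfolding s_def c_def by blast
  define e where "e = A + (cis (- \<theta>') - 1) * (s * A + c * (- B)) * s"
  have r3: "reach (T + (j+2) * (2*T+1)) (vec e 0)"
    using reach_circuit[OF r2 circuit_refl_reach[OF reach, of \<theta>']]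
    unfolding R e_def[symmetric] \<theta>' by (simp add: algebra_simps)
  have "cmod e = 1" using normv[OF r3] by (simp add: power2_eq_1_iff) (use norm_ge_zero[of e] in linarith)
  then show ?thesis by (intro reach_phase[OF r3]) (simp_all add: vec_def)
qed

end

text \<open>The estimate is conditional because in the middle range j is about pi / (8 |pi/4 -
  \<phi>|), which is unbounded.\<close>

lemma grover_iterations:
  fixes \<phi> :: real
  assumes "0 < \<phi>" "\<phi> < pi / 2" "\<phi> \<noteq> pi / 4"
  obtains j :: nat where "j \<ge> 1"
    "cos (real (2*j+3) * \<phi>) * cos (real (2*j+1) * \<phi>)
      * (cos ((real (2*j) - 1) * \<phi>) * cos ((real (2*j) - 3) * \<phi>)) \<le> 0"
    "\<phi> \<le> pi / 6 \<or> pi / 3 \<le> \<phi> \<longrightarrow> real (2*j+5) \<le> 9 / sin \<phi>"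
proof -
  consider "\<phi> \<le> pi / 6" | "pi / 3 \<le> \<phi>" | "pi / 6 < \<phi>" "\<phi> < pi / 3" by linarith
  then show ?thesis
  proof cases
    case 1
    then show ?thesis using grover_iterations_small_angle[OF assms(1) 1] that by metis
  next
    case 2
    then show ?thesis using grover_iterations_large_angle[OF 2] assms(2) that
      by (metis less_imp_le)
  next
    case 3
    from grover_iterations_middle_angle[OF 3 assms(3)] show ?thesis
      using that 3 by (metis not_le)
  qed
qed

section \<open>One parity split, and escape from the weight one half\<close>

lemma cis_nat_pi: "cis (- (real m * pi)) = (- 1) ^ m"
  using DeMoivre[of "- pi" m] by (simp add: cis.ctr complex_eq_iff flip: cis_cnj)

context spectral_search
begin

text \<open>With q = sin\<phi> squared, the thresholds 1/4 and 3/4 are the angles pi/6 and pi/3 of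
  \<open>grover_iterations\<close>. The bound concerns 2T+1 since amplification multiplies that by
  exactly 2j+5.\<close>

lemma parity_step:
  assumes reach: "reach T x" and supp: "\<And>\<mu>. x \<mu> \<noteq> 0 \<Longrightarrow> 2 ^ a dvd \<mu>"
    and q: "q = (\<Sum>\<mu> | \<mu> \<in> Lam \<and> 2 ^ Suc a dvd \<mu>. p \<mu> * (cmod (x \<mu>))\<^sup>2)"
    and q0: "0 < q" "q < 1" "q \<noteq> 1 / 2"
  obtains T' where "reach T' (\<lambda>\<mu>. if 2 ^ Suc a dvd \<mu> then x \<mu> / of_real (sqrt q) else 0)"
    "q \<le> 1/4 \<or> 3/4 \<le> q \<longrightarrow> real (2 * T' + 1) \<le> 9 / sqrt q * real (2 * T + 1)"
proof -
  define even where "even \<mu> \<longleftrightarrow> 2 ^ Suc a dvd \<mu>" for \<mu> :: nat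
  define u where "u \<mu> = (if even \<mu> then x \<mu> / of_real (sqrt q) else 0)" for \<mu>
  define v where "v \<mu> = (if even \<mu> then 0 else x \<mu> / of_real (sqrt (1 - q)))" for \<mu>
  define \<phi> where "\<phi> = arcsin (sqrt q)"
  have s1: "sqrt q < 1" "0 < sqrt q" using q0 by auto
  then have s2: "- 1 \<le> sqrt q" "sqrt q \<le> 1" by linarith+
  have sn: "sin \<phi> = sqrt q" unfolding \<phi>_def by (rule sin_arcsin[OF s2])
  have cs: "cos \<phi> = sqrt (1 - q)" unfolding \<phi>_def using q0 by (simp add: cos_arcsin[OF s2])
  have \<phi>0: "0 < \<phi>" using arcsin_less_arcsin[of 0 "sqrt q"] s1 by (simp add: \<phi>_def)
  have \<phi>2: "\<phi> < pi / 2" using arcsin_less_arcsin[of "sqrt q" 1] s1 by (simp add: \<phi>_def)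
  have q4: "\<phi> \<noteq> pi / 4"
  proof
    assume "\<phi> = pi / 4"
    then have "(sqrt q)\<^sup>2 = (sqrt 2 / 2)\<^sup>2" using sn sin_45 by metis
    then show False using q0 by (simp add: power_divide)
  qed
  have ang: "\<phi> \<le> pi / 6 \<or> pi / 3 \<le> \<phi>" if "q \<le> 1/4 \<or> 3/4 \<le> q"
    using that
  proof
    assume "q \<le> 1/4"
    then have "sqrt q \<le> sqrt (1/4)" by (rule real_sqrt_le_mono)
    then have "sqrt q \<le> sin (pi/6)" by (simp add: sin_30 real_sqrt_divide)
    then have "\<phi> \<le> pi/6" unfolding \<phi>_def using s2 pi_gt_zero by (subst arcsin_le_iff) auto
    then show ?thesis ..
  next
    assume "3/4 \<le> q"
    then have "sqrt (3/4) \<le> sqrt q" by (rule real_sqrt_le_mono)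
    then have "sin (pi/3) \<le> sqrt q" by (simp add: sin_60 real_sqrt_divide)
    then have "pi/3 \<le> \<phi>" unfolding \<phi>_def using s2 pi_gt_zero by (subst le_arcsin_iff) (auto intro: order_trans[of _ 0])
    then show ?thesis ..
  qed
  obtain j where j: "j \<ge> 1"
    "cos (real (2*j+3) * \<phi>) * cos (real (2*j+1) * \<phi>)
      * (cos ((real (2*j) - 1) * \<phi>) * cos ((real (2*j) - 3) * \<phi>)) \<le> 0"
    "\<phi> \<le> pi / 6 \<or> pi / 3 \<le> \<phi> \<longrightarrow> real (2*j+5) \<le> 9 / sin \<phi>"
    using grover_iterations[OF \<phi>0 \<phi>2 q4] by blast
  have xsplit: "x = (\<lambda>\<mu>. of_real (sin \<phi>) * u \<mu> + of_real (cos \<phi>) * v \<mu>)"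
    using q0 by (auto simp: u_def v_def sn cs fun_eq_iff)
  have w: "(\<Sum>\<mu>\<in>Lam. p \<mu> * (cmod (x \<mu>))\<^sup>2) = 1"
    using reach_norm[OF reach] unfolding ip_self by (metis of_real_eq_1_iff)
  have qe: "(\<Sum>\<mu>\<in>Lam. if even \<mu> then p \<mu> * (cmod (x \<mu>))\<^sup>2 else 0) = q"
    unfolding q even_def by (subst sum.inter_filter[symmetric]) (auto simp: fin)
  have qo: "(\<Sum>\<mu>\<in>Lam. if even \<mu> then 0 else p \<mu> * (cmod (x \<mu>))\<^sup>2) = 1 - q"
  proof -
    have "(\<Sum>\<mu>\<in>Lam. if even \<mu> then p \<mu> * (cmod (x \<mu>))\<^sup>2 else 0)
        + (\<Sum>\<mu>\<in>Lam. if even \<mu> then 0 else p \<mu> * (cmod (x \<mu>))\<^sup>2) = 1"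
      unfolding w[symmetric] sum.distrib[symmetric] by (rule sum.cong) auto
    then show ?thesis using qe by simp
  qed
  have "(\<Sum>\<mu>\<in>Lam. p \<mu> * (cmod (u \<mu>))\<^sup>2) = (\<Sum>\<mu>\<in>Lam. if even \<mu> then p \<mu> * (cmod (x \<mu>))\<^sup>2 else 0) / q"
    unfolding sum_divide_distrib
    by (rule sum.cong) (use q0 in \<open>auto simp: u_def norm_divide power_divide\<close>)
  then have uu: "ip u u = 1" unfolding ip_self qe using q0 by simp
  have "(\<Sum>\<mu>\<in>Lam. p \<mu> * (cmod (v \<mu>))\<^sup>2) = (\<Sum>\<mu>\<in>Lam. if even \<mu> then 0 else p \<mu> * (cmod (x \<mu>))\<^sup>2) / (1 - q)"
    unfolding sum_divide_distrib
    by (rule sum.cong) (use q0 in \<open>auto simp: v_def norm_divide power_divide\<close>)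
  then have vv: "ip v v = 1" unfolding ip_self qo using q0 by simp
  have uv: "ip u v = 0" unfolding ip_def by (rule sum.neutral) (simp add: u_def v_def)
  have phase: "cis (- real \<mu> * (pi / 2 ^ a)) = (if even \<mu> then 1 else - 1)" if "x \<mu> \<noteq> 0" for \<mu>
  proof -
    obtain m where m: "\<mu> = 2 ^ a * m" using supp[OF \<open>x \<mu> \<noteq> 0\<close>] by (auto simp: dvd_def)
    have "cis (- real \<mu> * (pi / 2 ^ a)) = (- 1) ^ m" by (simp add: m cis_nat_pi)
    moreover have "even \<mu> \<longleftrightarrow> 2 dvd m" by (simp add: even_def m mult.commute)
    ultimately show ?thesis by simp
  qed
  have wu: "walk (pi / 2 ^ a) u = u"
    by (rule ext) (use phase in \<open>auto simp: walk_def u_def\<close>)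
  have wv: "walk (pi / 2 ^ a) v = (\<lambda>\<mu>. - v \<mu>)"
  proof
    fix \<mu>
    show "walk (pi / 2 ^ a) v \<mu> = - v \<mu>"
      using phase[of \<mu>] by (cases "x \<mu> = 0") (auto simp: walk_def v_def)
  qed
  have r: "reach (T + (j + 2) * (2 * T + 1)) u"
    by (rule exact_amplification[OF reach \<phi>0 \<phi>2 j(1,2) xsplit uu vv uv wu wv])
  have "real (2 * (T + (j + 2) * (2 * T + 1)) + 1) \<le> 9 / sqrt q * real (2 * T + 1)"
    if "q \<le> 1/4 \<or> 3/4 \<le> q"
  proof -
    have "real (2*j+5) \<le> 9 / sqrt q" using mp[OF j(3) ang[OF that]] sn by simp
    then have "real (2*j+5) * real (2*T+1) \<le> 9 / sqrt q * real (2*T+1)"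
      by (rule mult_right_mono) simp
    then show ?thesis by (simp add: algebra_simps)
  qed
  then show ?thesis using that r unfolding u_def even_def by blast
qed

text \<open>As the eigenvalues are natural numbers, both sums are values of one polynomial at points
  of the unit circle. It takes the value 1 at 1, hence has finitely many roots, while t ranges over
  an interval that maps injectively to the circle.\<close>

lemma phase_sum_nonzero:
  fixes r :: "nat \<Rightarrow> real"
  assumes "sum r Lam = 1"
  obtains t :: real where "(\<Sum>\<mu>\<in>Lam. of_real (r \<mu>) * cis (- real \<mu> * t)) \<noteq> 0"
    "(\<Sum>\<mu>\<in>Lam. of_real (r \<mu>) * cis (- real \<mu> * (t + \<tau>))) \<noteq> 0"
proof -
  define P where "P = (\<Sum>\<mu>\<in>Lam. monom (complex_of_real (r \<mu>)) \<mu>)"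
  have P: "(\<Sum>\<mu>\<in>Lam. of_real (r \<mu>) * cis (- real \<mu> * t)) = poly P (cis (- t))" for t
    unfolding P_def poly_sum poly_monom
    by (simp only: Complex.DeMoivre mult_minus_left mult_minus_right)
  have "poly P 1 = of_real (sum r Lam)" unfolding P_def poly_sum poly_monom by simp
  then have "P \<noteq> 0" using assms by auto
  then have F: "finite {y. poly P y = 0}" by (rule poly_roots_finite)
  have inj: "inj_on (\<lambda>t. cis (- t) * z) {0<..<1}" if "z \<noteq> 0" for z
  proof (rule inj_onI)
    fix s t :: real
    assume st: "s \<in> {0<..<1}" "t \<in> {0<..<1}" and "cis (- s) * z = cis (- t) * z"
    then have "cis (- s) = cis (- t)" using that by simp
    then have "sin s = sin t" by (simp add: complex_eq_iff)
    then show "s = t" using st sin_inj_pi[of s t] pi_gt3 by auto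
  qed
  have fin': "finite {t \<in> {0<..<1::real}. poly P (cis (- t) * z) = 0}" if "z \<noteq> 0" for z
  proof (rule finite_imageD)
    show "finite ((\<lambda>t. cis (- t) * z) ` {t \<in> {0<..<1}. poly P (cis (- t) * z) = 0})"
      by (rule finite_subset[OF _ F]) auto
    show "inj_on (\<lambda>t. cis (- t) * z) {t \<in> {0<..<1}. poly P (cis (- t) * z) = 0}"
      by (rule inj_on_subset[OF inj[OF that]]) auto
  qed
  have "\<not> {0<..<1} \<subseteq> {t \<in> {0<..<1::real}. poly P (cis (- t) * 1) = 0}
      \<union> {t \<in> {0<..<1::real}. poly P (cis (- t) * cis (- \<tau>)) = 0}" (is "\<not> _ \<subseteq> ?A \<union> ?B")
  proof
    assume sub: "{0<..<1} \<subseteq> ?A \<union> ?B"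
    have "finite (?A \<union> ?B)" by (intro finite_UnI fin') auto
    from finite_subset[OF sub this] show False using infinite_Ioo[of 0 "1::real"] by simp
  qed
  then obtain t where "poly P (cis (- t)) \<noteq> 0" "poly P (cis (- t) * cis (- \<tau>)) \<noteq> 0" by auto
  then show ?thesis using that[of t] unfolding P by (simp add: cis_mult algebra_simps)
qed

text \<open>At \<open>q = 1/2\<close> the parity split only ever flips between two states, so first move off this
  weight. For \<open>z = \<langle>x|W\<^sub>t x\<rangle>\<close> and \<open>z' = \<langle>x|W\<^sub>t\<^sub>+\<^sub>\<tau> x\<rangle>\<close> the weights of the two parity classes in
  \<open>W\<^sub>t x + c z x\<close> differ by \<open>2 Re (cnj (c z) z')\<close>, which cannot vanish for both \<open>c = cis (\<minusplus> \<theta>) - 1\<close>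
  unless \<open>z z' = 0\<close>.\<close>
lemma perturb_half:
  assumes reach: "reach T x" and supp: "\<And>\<mu>. x \<mu> \<noteq> 0 \<Longrightarrow> 2 ^ a dvd \<mu>"
    and half: "(\<Sum>\<mu> | \<mu> \<in> Lam \<and> 2 ^ Suc a dvd \<mu>. p \<mu> * (cmod (x \<mu>))\<^sup>2) = 1 / 2"
  obtains T' y where "reach T' y" "\<And>\<mu>. y \<mu> = 0 \<longleftrightarrow> x \<mu> = 0"
    "(\<Sum>\<mu> | \<mu> \<in> Lam \<and> 2 ^ Suc a dvd \<mu>. p \<mu> * (cmod (y \<mu>))\<^sup>2) \<noteq> 1 / 2"
proof -
  define \<tau> where "\<tau> = pi / 2 ^ a"
  define r where "r \<mu> = p \<mu> * (cmod (x \<mu>))\<^sup>2" for \<mu>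
  define \<epsilon> :: "nat \<Rightarrow> real" where "\<epsilon> \<mu> = (if 2 ^ Suc a dvd \<mu> then 1 else - 1)" for \<mu>
  have total: "(\<Sum>\<mu>\<in>Lam. p \<mu> * (cmod (y \<mu>))\<^sup>2) = 1" if "reach S y" for S y
    using reach_norm[OF that] unfolding ip_self by (metis of_real_eq_1_iff)
  have rsum: "sum r Lam = 1" using total[OF reach] by (simp add: r_def)
  have rpos: "r \<mu> \<ge> 0" if "\<mu> \<in> Lam" for \<mu> using p_pos[OF that] by (simp add: r_def)
  have signed: "(\<Sum>\<mu>\<in>Lam. \<epsilon> \<mu> * f \<mu>) = 2 * (\<Sum>\<mu> | \<mu> \<in> Lam \<and> 2 ^ Suc a dvd \<mu>. f \<mu>) - sum f Lam" for f
  proof -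
    have "(\<Sum>\<mu> | \<mu> \<in> Lam \<and> 2 ^ Suc a dvd \<mu>. f \<mu>) = (\<Sum>\<mu>\<in>Lam. if 2 ^ Suc a dvd \<mu> then f \<mu> else 0)"
      by (subst sum.inter_filter[symmetric]) (auto simp: fin)
    moreover have "(\<Sum>\<mu>\<in>Lam. \<epsilon> \<mu> * f \<mu>) = (\<Sum>\<mu>\<in>Lam. 2 * (if 2 ^ Suc a dvd \<mu> then f \<mu> else 0) - f \<mu>)"
      by (rule sum.cong) (auto simp: \<epsilon>_def)
    ultimately show ?thesis by (simp only: sum_subtractf sum_distrib_left)
  qed
  have r\<epsilon>: "(\<Sum>\<mu>\<in>Lam. \<epsilon> \<mu> * r \<mu>) = 0" unfolding signed using half rsum by (simp add: r_def)
  obtain t where t: "(\<Sum>\<mu>\<in>Lam. of_real (r \<mu>) * cis (- real \<mu> * t)) \<noteq> 0"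
    "(\<Sum>\<mu>\<in>Lam. of_real (r \<mu>) * cis (- real \<mu> * (t + \<tau>))) \<noteq> 0"
    by (rule phase_sum_nonzero[OF rsum])
  define z where "z = (\<Sum>\<mu>\<in>Lam. of_real (r \<mu>) * cis (- real \<mu> * t))"
  define z' where "z' = (\<Sum>\<mu>\<in>Lam. of_real (r \<mu>) * cis (- real \<mu> * (t + \<tau>)))"
  have zz: "z \<noteq> 0" "z' \<noteq> 0" using t by (simp_all add: z_def z'_def)
  have zle: "cmod z \<le> 1"
  proof -
    have "cmod z \<le> (\<Sum>\<mu>\<in>Lam. cmod (of_real (r \<mu>) * cis (- real \<mu> * t)))"
      unfolding z_def by (rule norm_sum)
    also have "\<dots> = sum r Lam" by (rule sum.cong) (auto simp: norm_mult rpos)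
    finally show ?thesis by (simp add: rsum)
  qed
  have z'_eq: "z' = (\<Sum>\<mu>\<in>Lam. of_real (\<epsilon> \<mu> * r \<mu>) * cis (- real \<mu> * t))"
    unfolding z'_def
  proof (rule sum.cong[OF HOL.refl])
    fix \<mu>
    show "of_real (r \<mu>) * cis (- real \<mu> * (t + \<tau>)) = of_real (\<epsilon> \<mu> * r \<mu>) * cis (- real \<mu> * t)"
    proof (cases "x \<mu> = 0")
      case False
      obtain m where m: "\<mu> = 2 ^ a * m" using supp[OF False] by (auto simp: dvd_def)
      have "cis (- real \<mu> * \<tau>) = (- 1) ^ m" by (simp add: m cis_nat_pi \<tau>_def)
      moreover have "2 ^ Suc a dvd \<mu> \<longleftrightarrow> 2 dvd m" by (simp add: m mult.commute)
      ultimately have "cis (- real \<mu> * \<tau>) = of_real (\<epsilon> \<mu>)" by (simp add: \<epsilon>_def)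
      moreover have "cis (- real \<mu> * (t + \<tau>)) = cis (- real \<mu> * t) * cis (- real \<mu> * \<tau>)"
        by (simp add: cis_mult algebra_simps)
      ultimately show ?thesis by simp
    qed (simp add: r_def)
  qed
  have ipz: "ip x (walk t x) = z"
    unfolding ip_def walk_def z_def
  proof (rule sum.cong[OF HOL.refl])
    fix \<mu>
    have "complex_of_real (r \<mu>) = of_real (p \<mu>) * (x \<mu> * cnj (x \<mu>))"
      unfolding r_def of_real_mult complex_norm_square ..
    then show "complex_of_real (p \<mu>) * cnj (x \<mu>) * (cis (- real \<mu> * t) * x \<mu>)
        = complex_of_real (r \<mu>) * cis (- real \<mu> * t)" by (simp add: mult_ac)
  qed
  define c where "c \<theta> = cis (- \<theta>) - 1" for \<theta> :: real
  define y where "y \<theta> = refl x \<theta> (walk t x)" for \<theta>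
  have y: "y \<theta> \<mu> = x \<mu> * (cis (- real \<mu> * t) + c \<theta> * z)" for \<theta> \<mu>
    unfolding y_def refl_def ipz by (simp add: walk_def c_def algebra_simps)
  have ry: "reach ((2 * T + 1) + (0 + T)) (y \<theta>)" for \<theta>
    unfolding y_def
    by (rule reach_circuit[OF reach_circuit[OF reach circuit_walk] circuit_refl_reach[OF reach]])
  \<comment> \<open>The part common to all coordinates, 1 + |c z|^2, multiplies the signed sum of r,
    which is 0 at weight one half; only the cross term is left.\<close>
  have diff: "(\<Sum>\<mu>\<in>Lam. \<epsilon> \<mu> * (p \<mu> * (cmod (y \<theta> \<mu>))\<^sup>2)) = 2 * Re (cnj (c \<theta> * z) * z')" for \<theta>
  proof -
    have sq: "(cmod (cis b + w))\<^sup>2 = 1 + (cmod w)\<^sup>2 + 2 * Re (cnj w * cis b)" for b w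
    proof -
      have "(cos b)\<^sup>2 + (sin b)\<^sup>2 = 1" by simp
      then show ?thesis unfolding cmod_power2 by (simp add: power2_eq_square algebra_simps)
    qed
    have "(\<Sum>\<mu>\<in>Lam. \<epsilon> \<mu> * (p \<mu> * (cmod (y \<theta> \<mu>))\<^sup>2))
      = (\<Sum>\<mu>\<in>Lam. (1 + (cmod (c \<theta> * z))\<^sup>2) * (\<epsilon> \<mu> * r \<mu>)
          + 2 * Re (cnj (c \<theta> * z) * (of_real (\<epsilon> \<mu> * r \<mu>) * cis (- real \<mu> * t))))"
    proof (rule sum.cong[OF HOL.refl])
      fix \<mu>
      have "\<epsilon> \<mu> * (p \<mu> * (cmod (y \<theta> \<mu>))\<^sup>2)
        = (\<epsilon> \<mu> * r \<mu>) * (cmod (cis (- real \<mu> * t) + c \<theta> * z))\<^sup>2"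
        unfolding y norm_mult power_mult_distrib r_def by simp
      also have "\<dots> = (1 + (cmod (c \<theta> * z))\<^sup>2) * (\<epsilon> \<mu> * r \<mu>)
          + 2 * ((\<epsilon> \<mu> * r \<mu>) * Re (cnj (c \<theta> * z) * cis (- real \<mu> * t)))"
        unfolding sq by (simp only: algebra_simps)
      also have "(\<epsilon> \<mu> * r \<mu>) * Re (cnj (c \<theta> * z) * cis (- real \<mu> * t))
        = Re (of_real (\<epsilon> \<mu> * r \<mu>) * (cnj (c \<theta> * z) * cis (- real \<mu> * t)))"
        by simp
      finally show "\<epsilon> \<mu> * (p \<mu> * (cmod (y \<theta> \<mu>))\<^sup>2) = (1 + (cmod (c \<theta> * z))\<^sup>2) * (\<epsilon> \<mu> * r \<mu>)
          + 2 * Re (cnj (c \<theta> * z) * (of_real (\<epsilon> \<mu> * r \<mu>) * cis (- real \<mu> * t)))"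
        by (simp only: mult.left_commute)
    qed
    also have "\<dots> = (1 + (cmod (c \<theta> * z))\<^sup>2) * (\<Sum>\<mu>\<in>Lam. \<epsilon> \<mu> * r \<mu>) + 2 * Re (cnj (c \<theta> * z) * z')"
      unfolding z'_eq by (simp only: sum.distrib sum_distrib_left Re_sum)
    finally show ?thesis by (simp add: r\<epsilon>)
  qed
  \<comment> \<open>The angle pi/6 is small enough that |c| < 1, since |c|^2 = 2 - sqrt 3. Each
    factor by which a coordinate of x is multiplied is then nonzero, and the support is
    unchanged.\<close>
  have cc: "cmod (c \<theta>) < 1" if "\<bar>\<theta>\<bar> = pi / 6" for \<theta>
  proof -
    have "cos \<theta> = sqrt 3 / 2" using that cos_30 by (metis cos_abs_real)
    moreover have "1 < sqrt (3::real)" by simp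
    moreover have "(cmod (c \<theta>))\<^sup>2 = ((cos \<theta>)\<^sup>2 + (sin \<theta>)\<^sup>2) + 1 - 2 * cos \<theta>"
      unfolding c_def cmod_power2 by (simp add: power2_eq_square algebra_simps)
    moreover have "(cos \<theta>)\<^sup>2 + (sin \<theta>)\<^sup>2 = 1" by simp
    ultimately have "(cmod (c \<theta>))\<^sup>2 < 1\<^sup>2" unfolding one_power2 by linarith
    then show ?thesis by (rule power2_less_imp_less) simp
  qed
  have yz: "y \<theta> \<mu> = 0 \<longleftrightarrow> x \<mu> = 0" if "\<bar>\<theta>\<bar> = pi / 6" for \<theta> \<mu>
  proof -
    have "cmod (c \<theta> * z) < 1"
      unfolding norm_mult using mult_left_mono[OF zle norm_ge_zero[of "c \<theta>"]] cc[OF that] by simp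
    then have "cis (- real \<mu> * t) + c \<theta> * z \<noteq> 0"
      by (metis add_eq_0_iff norm_cis norm_minus_cancel order_less_irrefl)
    then show ?thesis by (simp add: y)
  qed
  have "\<exists>\<theta>. \<bar>\<theta>\<bar> = pi / 6 \<and> Re (cnj (c \<theta> * z) * z') \<noteq> 0"
  proof (rule ccontr)
    assume "\<not> ?thesis"
    then have h: "Re (cnj (c (pi/6) * z) * z') = 0" "Re (cnj (c (- (pi/6)) * z) * z') = 0" by auto
    define w where "w = cnj z * z'"
    have cw: "Re (cnj (c \<theta> * z) * z') = (cos \<theta> - 1) * Re w - sin \<theta> * Im w" for \<theta>
      unfolding w_def c_def by (simp add: algebra_simps)
    have "(cos (pi/6) - 1) * Re w - sin (pi/6) * Im w = 0"
      "(cos (pi/6) - 1) * Re w + sin (pi/6) * Im w = 0"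
      using h unfolding cw by simp_all
    then have "(cos (pi/6) - 1) * Re w = 0" "sin (pi/6) * Im w = 0" by linarith+
    moreover have "sqrt 3 \<noteq> 2" by (metis numeral_eq_iff num.distinct real_sqrt_four real_sqrt_eq_iff semiring_norm(83) semiring_norm(88))
    ultimately have "w = 0" by (auto simp: cos_30 sin_30 complex_eq_iff)
    then show False using zz by (simp add: w_def)
  qed
  then obtain \<theta> where \<theta>: "\<bar>\<theta>\<bar> = pi / 6" "Re (cnj (c \<theta> * z) * z') \<noteq> 0" by blast
  have "(\<Sum>\<mu> | \<mu> \<in> Lam \<and> 2 ^ Suc a dvd \<mu>. p \<mu> * (cmod (y \<theta> \<mu>))\<^sup>2) \<noteq> 1 / 2"
    using diff[of \<theta>] \<theta>(2) unfolding signed total[OF ry] by auto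
  then show ?thesis using that[OF ry yz[OF \<theta>(1)]] by blast
qed

section \<open>Descent through the powers of two to the eigenvalue zero\<close>

lemma power_dvd_only_zero: obtains a where "\<And>\<mu>. \<mu> \<in> Lam \<Longrightarrow> 2 ^ a dvd \<mu> \<Longrightarrow> \<mu> = 0"
proof -
  have "\<mu> = 0" if "\<mu> \<in> Lam" "2 ^ Suc (Max Lam) dvd \<mu>" for \<mu>
  proof (rule ccontr)
    assume "\<mu> \<noteq> 0"
    then have "2 ^ Suc (Max Lam) \<le> \<mu>" using that(2) by (simp add: dvd_imp_le)
    also have "\<mu> \<le> Max Lam" using fin that(1) by simp
    also have "Max Lam < 2 ^ Suc (Max Lam)" by (meson less_exp lessI less_trans)
    finally show False by simp
  qed
  then show ?thesis by (rule that)
qed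

text \<open>No cost is tracked here; this serves the small n. Perturbations destroy the explicit
  form of the amplitudes, so the invariant retains only the support and x(0) \<noteq> 0, which keeps
  q positive. A unit vector supported at 0 alone is the target up to a phase.\<close>

lemma reach_zero: "\<exists>T. reach T (\<lambda>\<mu>. if \<mu> = 0 then 1 / of_real (sqrt (p 0)) else 0)"
proof -
  have *: "\<exists>T x. reach T x \<and> (\<forall>\<mu>. x \<mu> \<noteq> 0 \<longrightarrow> \<mu> \<in> Lam \<and> 2 ^ a dvd \<mu>) \<and> x 0 \<noteq> 0" for a
  proof (induction a)
    case 0
    have "one \<mu> \<noteq> 0 \<longleftrightarrow> \<mu> \<in> Lam" for \<mu> by (simp add: one_def)
    then show ?case using reach_one zero_in by (intro exI[of _ 0] exI[of _ one]) auto
  next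
    case (Suc a)
    define q where "q x = (\<Sum>\<mu> | \<mu> \<in> Lam \<and> 2 ^ Suc a dvd \<mu>. p \<mu> * (cmod (x \<mu>))\<^sup>2)" for x
    from Suc obtain T x where x: "reach T x" "\<And>\<mu>. x \<mu> \<noteq> 0 \<Longrightarrow> \<mu> \<in> Lam \<and> 2 ^ a dvd \<mu>" "x 0 \<noteq> 0"
      by blast
    obtain T' y where y: "reach T' y" "\<And>\<mu>. y \<mu> \<noteq> 0 \<Longrightarrow> \<mu> \<in> Lam \<and> 2 ^ a dvd \<mu>" "y 0 \<noteq> 0" "q y \<noteq> 1 / 2"
    proof (cases "q x = 1 / 2")
      case True
      obtain T' y where "reach T' y" "\<And>\<mu>. y \<mu> = 0 \<longleftrightarrow> x \<mu> = 0" "q y \<noteq> 1 / 2"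
        by (rule perturb_half[OF x(1) conjunct2[OF x(2)] True[unfolded q_def], folded q_def]) blast+
      then show ?thesis using that x by metis
    qed (use that x in blast)
    have q0: "q y > 0"
    proof -
      have "p 0 * (cmod (y 0))\<^sup>2 \<le> q y" unfolding q_def
        by (rule member_le_sum) (auto simp: fin zero_in less_imp_le[OF p_pos])
      moreover have "p 0 * (cmod (y 0))\<^sup>2 > 0" using y(3) p_pos[OF zero_in] by simp
      ultimately show ?thesis by linarith
    qed
    have tot: "(\<Sum>\<mu>\<in>Lam. p \<mu> * (cmod (y \<mu>))\<^sup>2) = 1"
      using reach_norm[OF y(1)] unfolding ip_self by (metis of_real_eq_1_iff)
    have "q y + (\<Sum>\<mu>\<in>Lam - {\<mu> \<in> Lam. 2 ^ Suc a dvd \<mu>}. p \<mu> * (cmod (y \<mu>))\<^sup>2) = 1"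
      unfolding q_def tot[symmetric] by (subst add.commute, rule sum.subset_diff[symmetric]) (auto simp: fin)
    moreover have nn: "\<And>\<mu>. \<mu> \<in> Lam \<Longrightarrow> 0 \<le> p \<mu> * (cmod (y \<mu>))\<^sup>2" using p_pos by (simp add: less_imp_le)
    ultimately have q1: "q y \<le> 1"
      and qeq: "q y = 1 \<Longrightarrow> (\<Sum>\<mu>\<in>Lam - {\<mu> \<in> Lam. 2 ^ Suc a dvd \<mu>}. p \<mu> * (cmod (y \<mu>))\<^sup>2) = 0"
      using sum_nonneg[of "Lam - {\<mu> \<in> Lam. 2 ^ Suc a dvd \<mu>}" "\<lambda>\<mu>. p \<mu> * (cmod (y \<mu>))\<^sup>2"] by auto
    show ?case
    proof (cases "q y = 1")
      case True
      have "\<forall>\<mu>\<in>Lam - {\<mu> \<in> Lam. 2 ^ Suc a dvd \<mu>}. p \<mu> * (cmod (y \<mu>))\<^sup>2 = 0"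
        using qeq[OF True] nn fin by (subst (asm) sum_nonneg_eq_0_iff) auto
      then have "p \<mu> * (cmod (y \<mu>))\<^sup>2 = 0" if "\<mu> \<in> Lam" "\<not> 2 ^ Suc a dvd \<mu>" for \<mu>
        using that by blast
      then have "y \<mu> = 0" if "\<mu> \<in> Lam" "\<not> 2 ^ Suc a dvd \<mu>" for \<mu>
        using that p_pos[of \<mu>] by fastforce
      then show ?thesis using y by blast
    next
      case False
      then have "q y < 1" using q1 by simp
      then obtain S where "reach S (\<lambda>\<mu>. if 2 ^ Suc a dvd \<mu> then y \<mu> / of_real (sqrt (q y)) else 0)"
        using parity_step[OF y(1) conjunct2[OF y(2)] q_def q0 _ y(4)] by blast
      then show ?thesis using y q0
        by (intro exI[of _ S] exI[of _ "\<lambda>\<mu>. if 2 ^ Suc a dvd \<mu> then y \<mu> / of_real (sqrt (q y)) else 0"]) auto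
    qed
  qed
  obtain a where a: "\<And>\<mu>. \<mu> \<in> Lam \<Longrightarrow> 2 ^ a dvd \<mu> \<Longrightarrow> \<mu> = 0" by (rule power_dvd_only_zero) blast
  from *[of a] obtain T x where x: "reach T x" "\<And>\<mu>. x \<mu> \<noteq> 0 \<Longrightarrow> \<mu> = 0" using a by blast
  have "(\<Sum>\<mu>\<in>Lam. p \<mu> * (cmod (x \<mu>))\<^sup>2) = p 0 * (cmod (x 0))\<^sup>2"
    using x(2) by (subst sum.remove[OF fin zero_in]) (auto intro!: sum.neutral)
  moreover have "(\<Sum>\<mu>\<in>Lam. p \<mu> * (cmod (x \<mu>))\<^sup>2) = 1"
    using reach_norm[OF x(1)] unfolding ip_self by (metis of_real_eq_1_iff)
  ultimately have "(sqrt (p 0) * cmod (x 0))\<^sup>2 = 1"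
    using p_pos[OF zero_in] by (simp add: power_mult_distrib)
  then have "cmod (of_real (sqrt (p 0)) * x 0) = 1"
    using p_pos[OF zero_in] by (simp add: norm_mult power2_eq_1_iff)
      (smt (verit) mult_nonneg_nonneg norm_ge_zero real_sqrt_ge_zero)
  then have "reach T (\<lambda>\<mu>. if \<mu> = 0 then 1 / of_real (sqrt (p 0)) else 0)"
    by (intro reach_phase[OF x(1), of "of_real (sqrt (p 0)) * x 0"])
       (use x(2) p_pos[OF zero_in] in auto)
  then show ?thesis ..
qed

text \<open>Since one eigenvalue of the current support carries at least three quarters of the weight,
  every split has ratio at most \<open>1/4\<close> or at least \<open>3/4\<close>, and the costs \<open>9 / sqrt q\<close> telescope.\<close>
lemma reach_zero_bound:
  assumes dom: "\<And>M. M \<in> Lam \<Longrightarrow> M \<noteq> 0 \<Longrightarrow> 3 * (\<Sum>\<mu> | \<mu> \<in> Lam \<and> \<mu> < M. p \<mu>) \<le> p M"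
  shows "\<exists>T. reach T (\<lambda>\<mu>. if \<mu> = 0 then 1 / of_real (sqrt (p 0)) else 0)
    \<and> real T \<le> 9 ^ card Lam / sqrt (p 0)"
proof -
  define S where "S a = {\<mu> \<in> Lam. 2 ^ a dvd \<mu>}" for a
  define P where "P a = sum p (S a)" for a
  \<comment> \<open>The normalised projection of \<open>one\<close> to the eigenvalues divisible by
    \<open>2 ^ a\<close>; \<open>P a\<close> is the weight of that projection.\<close>
  define X where "X a = (\<lambda>\<mu>. if \<mu> \<in> S a then 1 / complex_of_real (sqrt (P a)) else 0)" for a
  have finS: "finite (S a)" for a using fin by (simp add: S_def)
  have Ppos: "P a > 0" for a
    unfolding P_def by (rule sum_pos[OF finS]) (use zero_in p_pos in \<open>auto simp: S_def\<close>)
  have Ssub: "S (Suc a) \<subseteq> S a" for a by (auto simp: S_def intro: dvd_trans[OF le_imp_power_dvd])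
  \<comment> \<open>The exponent bounds the number of proper splits made so far, each of which
    removes at least one eigenvalue; levels that remove none cost nothing.\<close>
  have "\<exists>T. reach T (X a) \<and> real (2 * T + 1) \<le> 9 ^ (card Lam - card (S a)) / sqrt (P a)" for a
  proof (induction a)
    case 0
    have "S 0 = Lam" by (auto simp: S_def)
    moreover from this have "P 0 = 1" by (simp add: P_def p_sum)
    moreover have "X 0 = one" by (rule ext) (simp add: X_def calculation one_def)
    ultimately show ?case using reach_one by (intro exI[of _ 0]) simp
  next
    case (Suc a)
    then obtain T where T: "reach T (X a)" "real (2 * T + 1) \<le> 9 ^ (card Lam - card (S a)) / sqrt (P a)"
      by blast
    show ?case
    proof (cases "S (Suc a) = S a")
      case True
      then have "P (Suc a) = P a" by (simp add: P_def)
      with True have "X (Suc a) = X a" by (simp add: X_def cong: if_cong)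
      then show ?thesis using T True \<open>P (Suc a) = P a\<close> by auto
    next
      case False
      define q where "q = P (Suc a) / P a"
      have Pdiff: "P a = P (Suc a) + sum p (S a - S (Suc a))"
        unfolding P_def by (subst add.commute, rule sum.subset_diff[OF Ssub finS])
      have "sum p (S a - S (Suc a)) > 0"
        by (rule sum_pos) (use False Ssub finS p_pos in \<open>auto simp: S_def\<close>)
      then have q01: "0 < q" "q < 1" using Pdiff Ppos[of a] Ppos[of "Suc a"] by (auto simp: q_def)
      define M where "M = Max (S a)"
      have ne: "S a \<noteq> {}" using zero_in by (auto simp: S_def)
      have MS: "M \<in> S a" and Mle: "\<And>\<mu>. \<mu> \<in> S a \<Longrightarrow> \<mu> \<le> M"
        using Max_in[OF finS ne] Max_ge[OF finS] by (auto simp: M_def)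
      have "\<exists>\<mu>\<in>S a. \<mu> \<noteq> 0"
      proof (rule ccontr)
        assume "\<not> ?thesis"
        then have "S a \<subseteq> S (Suc a)" using zero_in by (auto simp: S_def)
        then show False using False Ssub by blast
      qed
      then have M0: "M \<noteq> 0" using Mle by fastforce
      define \<sigma> where "\<sigma> = (\<Sum>\<mu> | \<mu> \<in> Lam \<and> \<mu> < M. p \<mu>)"
      have \<sigma>: "3 * \<sigma> \<le> p M" unfolding \<sigma>_def by (rule dom) (use MS M0 in \<open>auto simp: S_def\<close>)
      have small: "sum p A \<le> \<sigma>" if "A \<subseteq> S a" "M \<notin> A" for A
        unfolding \<sigma>_def
      proof (rule sum_mono2)
        show "finite {\<mu> \<in> Lam. \<mu> < M}" using fin by simp
        have "\<mu> \<in> Lam \<and> \<mu> < M" if "\<mu> \<in> A" for \<mu>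
          using that \<open>A \<subseteq> S a\<close> \<open>M \<notin> A\<close> Mle[of \<mu>] by (cases "\<mu> = M") (auto simp: S_def)
        then show "A \<subseteq> {\<mu> \<in> Lam. \<mu> < M}" by blast
        show "0 \<le> p \<mu>" if "\<mu> \<in> {\<mu> \<in> Lam. \<mu> < M} - A" for \<mu>
          using that p_pos[of \<mu>] by simp
      qed
      have big: "p M \<le> sum p A" if "A \<subseteq> S a" "M \<in> A" for A
        by (rule member_le_sum) (use that finS p_pos in \<open>auto simp: S_def intro: finite_subset less_imp_le\<close>)
      have q4: "q \<le> 1/4 \<or> 3/4 \<le> q"
      proof (cases "M \<in> S (Suc a)")
        case True
        have "p M \<le> P (Suc a)" unfolding P_def by (rule big[OF Ssub True])
        moreover have "sum p (S a - S (Suc a)) \<le> \<sigma>" by (rule small) (use True in auto)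
        ultimately have "3 * P a \<le> 4 * P (Suc a)" using \<sigma> Pdiff by linarith
        then show ?thesis using Ppos[of a] by (simp add: q_def field_simps)
      next
        case False
        have "p M \<le> sum p (S a - S (Suc a))" by (rule big) (use False MS in auto)
        moreover have "P (Suc a) \<le> \<sigma>" unfolding P_def by (rule small[OF Ssub False])
        ultimately have "4 * P (Suc a) \<le> P a" using \<sigma> Pdiff by linarith
        then show ?thesis using Ppos[of a] by (simp add: q_def field_simps)
      qed
      have qsum: "q = (\<Sum>\<mu> | \<mu> \<in> Lam \<and> 2 ^ Suc a dvd \<mu>. p \<mu> * (cmod (X a \<mu>))\<^sup>2)"
      proof -
        have "(\<Sum>\<mu> | \<mu> \<in> Lam \<and> 2 ^ Suc a dvd \<mu>. p \<mu> * (cmod (X a \<mu>))\<^sup>2) = (\<Sum>\<mu>\<in>S (Suc a). p \<mu> / P a)"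
          by (rule sum.cong)
             (use Ssub Ppos[of a] in \<open>auto simp: X_def norm_divide power_divide S_def\<close>)
        then show ?thesis by (simp add: q_def P_def sum_divide_distrib)
      qed
      have supp: "X a \<mu> \<noteq> 0 \<Longrightarrow> 2 ^ a dvd \<mu>" for \<mu> by (auto simp: X_def S_def split: if_splits)
      have qh: "q \<noteq> 1 / 2" using q4 by auto
      obtain T' where T': "reach T' (\<lambda>\<mu>. if 2 ^ Suc a dvd \<mu> then X a \<mu> / of_real (sqrt q) else 0)"
        "real (2 * T' + 1) \<le> 9 / sqrt q * real (2 * T + 1)"
        using parity_step[OF T(1) supp qsum q01 qh] q4 by blast
      have "(\<lambda>\<mu>. if 2 ^ Suc a dvd \<mu> then X a \<mu> / of_real (sqrt q) else 0) = X (Suc a)"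
      proof
        fix \<mu>
        have "sqrt (P a) * sqrt q = sqrt (P (Suc a))"
          using Ppos[of a] by (simp add: q_def flip: real_sqrt_mult)
        then have "complex_of_real (sqrt (P a)) * of_real (sqrt q) = of_real (sqrt (P (Suc a)))"
          by (metis of_real_mult)
        moreover have "\<mu> \<in> S (Suc a) \<longleftrightarrow> \<mu> \<in> S a \<and> 2 ^ Suc a dvd \<mu>" using Ssub[of a] by (auto simp: S_def)
        ultimately show "(if 2 ^ Suc a dvd \<mu> then X a \<mu> / of_real (sqrt q) else 0) = X (Suc a) \<mu>"
          by (simp add: X_def)
      qed
      moreover have "real (2 * T' + 1) \<le> 9 ^ (card Lam - card (S (Suc a))) / sqrt (P (Suc a))"
      proof -
        have c1: "card (S (Suc a)) < card (S a)"
          using Ssub False by (intro psubset_card_mono[OF finS]) auto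
        have c2: "card (S a) \<le> card Lam" by (rule card_mono[OF fin]) (auto simp: S_def)
        have "real (2 * T' + 1) \<le> 9 / sqrt q * (9 ^ (card Lam - card (S a)) / sqrt (P a))"
          by (rule order_trans[OF T'(2) mult_left_mono[OF T(2)]]) (use q01 in auto)
        also have "\<dots> = 9 ^ Suc (card Lam - card (S a)) / sqrt (q * P a)"
          by (simp add: real_sqrt_mult)
        also have "q * P a = P (Suc a)" using Ppos[of a] by (simp add: q_def)
        also have "9 ^ Suc (card Lam - card (S a)) / sqrt (P (Suc a))
            \<le> 9 ^ (card Lam - card (S (Suc a))) / sqrt (P (Suc a))"
          by (intro divide_right_mono power_increasing) (use c1 c2 Ppos[of "Suc a"] in auto)
        finally show ?thesis .
      qed
      ultimately show ?thesis using T'(1) by auto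
    qed
  qed
  note * = this
  obtain a where a: "\<And>\<mu>. \<mu> \<in> Lam \<Longrightarrow> 2 ^ a dvd \<mu> \<Longrightarrow> \<mu> = 0" by (rule power_dvd_only_zero) blast
  have S0: "S a = {0}" using a zero_in by (auto simp: S_def)
  then have P0: "P a = p 0" by (simp add: P_def)
  have X0: "X a = (\<lambda>\<mu>. if \<mu> = 0 then 1 / of_real (sqrt (p 0)) else 0)" unfolding X_def S0 P0 by simp
  from *[of a] obtain T where T: "reach T (X a)" "real (2 * T + 1) \<le> 9 ^ (card Lam - card (S a)) / sqrt (P a)"
    by blast
  have "real T \<le> 9 ^ (card Lam - card (S a)) / sqrt (p 0)" using T(2) unfolding P0 by linarith
  also have "\<dots> \<le> 9 ^ card Lam / sqrt (p 0)"
    by (intro divide_right_mono power_increasing) (use p_pos[OF zero_in] in auto)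
  finally show ?thesis using T(1) unfolding X0 by blast
qed

end

subsection \<open>Spectrum of the Johnson graph\<close>

text \<open>The Laplacian of \<open>J(n,k)\<close> on functions of \<open>i = card (m \<inter> v)\<close>.\<close>
locale johnson_radial =
  fixes n k :: nat
  assumes kn: "k \<le> n"
begin

text \<open>A neighbour of v raises i by trading an element of v - m for one of m - v, in (k-i)^2
  ways, and lowers it by trading an element of the intersection for one outside m and v, in
  i(n-2k+i) ways. The truncated i - 1 at i = 0 carries the coefficient 0.\<close>

definition lap :: "(nat \<Rightarrow> real) \<Rightarrow> nat \<Rightarrow> real" where
  "lap f i = (real k - real i)\<^sup>2 * (f i - f (i + 1))
     + real i * (real n - 2 * real k + real i) * (f i - f (i - 1))"

definition weight :: "nat \<Rightarrow> real" where
  "weight i = real (k choose i) * real ((n - k) choose (k - i))"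

text \<open>The values of card (m \<inter> v) that occur: 2k \<le> n + i says that the union, of
  size 2k - i, fits into n points.\<close>

definition sizes :: "nat set" where
  "sizes = {i. i \<le> k \<and> 2 * k \<le> n + i}"

text \<open>The inner product over the vertex set for functions of card (m \<inter> v), since
  \<open>weight i\<close> counts the vertices v with value i.\<close>

definition form :: "(nat \<Rightarrow> real) \<Rightarrow> (nat \<Rightarrow> real) \<Rightarrow> real" where
  "form f g = (\<Sum>i\<le>k. weight i * f i * g i)"

definition lam :: "nat \<Rightarrow> nat" where
  "lam j = j * (n + 1 - j)"

lemma lap_linear: "lap (\<lambda>i. a * f i + b * g i) i = a * lap f i + b * lap g i"
  by (simp add: lap_def algebra_simps)

lemma lap_sum: "finite A \<Longrightarrow> lap (\<lambda>i. \<Sum>x\<in>A. f x i) i = (\<Sum>x\<in>A. lap (f x) i)"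
proof (induction A rule: finite_induct)
  case empty
  show ?case by (simp add: lap_def)
next
  case (insert x A)
  then show ?case using lap_linear[of 1 "f x" 1 "\<lambda>i. \<Sum>x\<in>A. f x i" i] by simp
qed

text \<open>The coefficients vanish at both ends of \<open>sizes\<close>, so values outside it never
  enter.\<close>

lemma lap_cong:
  assumes eq: "\<And>i. i \<in> sizes \<Longrightarrow> f i = g i" and i: "i \<in> sizes"
  shows "lap f i = lap g i"
proof -
  have "(real k - real i)\<^sup>2 * (f i - f (i + 1)) = (real k - real i)\<^sup>2 * (g i - g (i + 1))"
    using i eq[OF i] eq[of "i + 1"] by (cases "i = k") (auto simp: sizes_def)
  moreover have "real i * (real n - 2 * real k + real i) * (f i - f (i - 1))
      = real i * (real n - 2 * real k + real i) * (g i - g (i - 1))"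
  proof (cases "i = 0 \<or> 2 * k = n + i")
    case True
    then have "real i * (real n - 2 * real k + real i) = 0" by (auto simp flip: of_nat_eq_iff)
    then show ?thesis by simp
  next
    case False
    then have "i - 1 \<in> sizes" using i by (auto simp: sizes_def)
    then show ?thesis using eq[OF i] eq[of "i - 1"] by simp
  qed
  ultimately show ?thesis by (simp only: lap_def)
qed

lemma weight_pos: "i \<in> sizes \<Longrightarrow> weight i > 0"
  by (auto simp: weight_def sizes_def zero_less_binomial_iff)

lemma weight_zero: "i \<le> k \<Longrightarrow> i \<notin> sizes \<Longrightarrow> weight i = 0"
  using kn by (auto simp: weight_def sizes_def binomial_eq_0_iff)

lemma top_size: "k \<in> sizes"
  using kn by (simp add: sizes_def)

text \<open>Detailed balance: both sides count the edges between the vertices at i and those at i +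
  1.\<close>

lemma weight_balance:
  assumes "i < k"
  shows "weight (i + 1) * (real (i + 1) * (real n - 2 * real k + real (i + 1)))
    = weight i * (real k - real i)\<^sup>2"
proof -
  have a: "real (k choose (i + 1)) * real (i + 1) = real (k choose i) * (real k - real i)"
  proof -
    have "(k choose Suc i) * Suc i = (k choose i) * (k - i)"
      by (metis mult.commute binomial_absorption binomial_absorb_comp)
    then have "real ((k choose Suc i) * Suc i) = real ((k choose i) * (k - i))" by simp
    then show ?thesis using assms by (simp only: of_nat_mult of_nat_diff less_imp_le) simp
  qed
  have b: "real ((n - k) choose (k - (i + 1))) * (real n - 2 * real k + real (i + 1))
      = real ((n - k) choose (k - i)) * (real k - real i)"
  proof -
    define d where "d = k - (i + 1)"
    have kd: "k - i = Suc d" "real k - real i = real (Suc d)" using assms by (auto simp: d_def)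
    show ?thesis
    proof (cases "d \<le> n - k")
      case True
      have "((n - k) choose Suc d) * Suc d = ((n - k) choose d) * (n - k - d)"
        by (metis mult.commute binomial_absorption binomial_absorb_comp)
      then have "real ((n - k) choose Suc d) * real (Suc d) = real ((n - k) choose d) * real (n - k - d)"
        by (metis of_nat_mult)
      moreover have "real (n - k - d) = real n - 2 * real k + real (i + 1)"
        using True kn assms by (simp add: d_def of_nat_diff)
      ultimately show ?thesis unfolding kd d_def[symmetric] by simp
    next
      case False
      then show ?thesis unfolding kd d_def[symmetric] by (simp add: binomial_eq_0)
    qed
  qed
  have "weight (i + 1) * (real (i + 1) * (real n - 2 * real k + real (i + 1)))
    = (real (k choose (i + 1)) * real (i + 1)) * (real ((n - k) choose (k - (i + 1))) * (real n - 2 * real k + real (i + 1)))"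
    by (simp only: weight_def mult_ac)
  also have "\<dots> = weight i * (real k - real i)\<^sup>2"
    unfolding a b by (simp only: weight_def power2_eq_square mult_ac)
  finally show ?thesis .
qed

text \<open>Summation by parts gives the Dirichlet form. Its symmetry makes \<open>lap\<close>
  self-adjoint, and its diagonal identifies the kernel with the constants.\<close>

lemma form_lap:
  "form (lap f) g = (\<Sum>i<k. weight i * (real k - real i)\<^sup>2 * ((f i - f (i + 1)) * (g i - g (i + 1))))"
proof -
  define b where "b i = weight i * (real k - real i)\<^sup>2" for i
  have 1: "(\<Sum>i\<le>k. b i * ((f i - f (i + 1)) * g i)) = (\<Sum>i<k. b i * ((f i - f (i + 1)) * g i))"
    by (simp add: b_def flip: lessThan_Suc_atMost)
  have "(\<Sum>i\<le>k. weight i * (real i * (real n - 2 * real k + real i)) * ((f i - f (i - 1)) * g i))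
      = (\<Sum>i<k. weight (i + 1) * (real (i + 1) * (real n - 2 * real k + real (i + 1))) * ((f (i + 1) - f i) * g (i + 1)))"
    unfolding lessThan_Suc_atMost[symmetric] by (subst sum.lessThan_Suc_shift) simp
  also have "\<dots> = (\<Sum>i<k. b i * ((f (i + 1) - f i) * g (i + 1)))"
    by (rule sum.cong) (simp_all only: weight_balance b_def lessThan_iff)
  finally have 2: "(\<Sum>i\<le>k. weight i * (real i * (real n - 2 * real k + real i)) * ((f i - f (i - 1)) * g i))
      = (\<Sum>i<k. b i * ((f (i + 1) - f i) * g (i + 1)))" .
  have "form (lap f) g = (\<Sum>i\<le>k. b i * ((f i - f (i + 1)) * g i)
      + weight i * (real i * (real n - 2 * real k + real i)) * ((f i - f (i - 1)) * g i))"
    unfolding form_def lap_def b_def by (rule sum.cong) (simp_all add: algebra_simps)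
  also have "\<dots> = (\<Sum>i<k. b i * ((f i - f (i + 1)) * g i)) + (\<Sum>i<k. b i * ((f (i + 1) - f i) * g (i + 1)))"
    unfolding sum.distrib 1 2 ..
  also have "\<dots> = (\<Sum>i<k. b i * ((f i - f (i + 1)) * (g i - g (i + 1))))"
    unfolding sum.distrib[symmetric] by (rule sum.cong) (simp_all add: algebra_simps)
  finally show ?thesis by (simp add: b_def)
qed

lemma form_commute: "form f g = form g f"
  by (simp add: form_def mult_ac)

lemma form_lap_symmetric: "form (lap f) g = form f (lap g)"
  unfolding form_commute[of f] form_lap by (simp add: mult_ac)

lemma form_cong:
  assumes "\<And>i. i \<in> sizes \<Longrightarrow> f i = f' i" "\<And>i. i \<in> sizes \<Longrightarrow> g i = g' i"
  shows "form f g = form f' g'"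
  unfolding form_def
proof (rule sum.cong[OF refl])
  fix i assume "i \<in> {..k}"
  then show "weight i * f i * g i = weight i * f' i * g' i"
    using weight_zero[of i] assms[of i] by (cases "i \<in> sizes") auto
qed

lemma form_scale: "form (\<lambda>i. c * f i) g = c * form f g"
  by (simp add: form_def sum_distrib_left mult_ac)

lemma form_sum: "form (\<lambda>i. \<Sum>x\<in>A. f x i) g = (\<Sum>x\<in>A. form (f x) g)"
  unfolding form_def sum_distrib_left sum_distrib_right by (rule sum.swap)

lemma form_self_nonneg: "form f f \<ge> 0"
  unfolding form_def by (intro sum_nonneg) (simp add: weight_def mult.assoc)

lemma form_self_zero:
  assumes "form f f = 0" "i \<in> sizes"
  shows "f i = 0"
proof -
  have "\<forall>i\<in>{..k}. weight i * f i * f i = 0"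
    using assms(1) unfolding form_def
    by (subst (asm) sum_nonneg_eq_0_iff) (auto simp: weight_def mult.assoc)
  then have "weight i * f i * f i = 0" using assms(2) by (simp add: sizes_def)
  then show ?thesis using weight_pos[OF assms(2)] by simp
qed

text \<open>The zero function qualifies, so a decomposition may contain vanishing
  components.\<close>

definition eigen :: "nat \<Rightarrow> (nat \<Rightarrow> real) \<Rightarrow> bool" where
  "eigen \<mu> f \<longleftrightarrow> (\<forall>i\<in>sizes. lap f i = real \<mu> * f i)"

lemma eigen_orthogonal:
  assumes "eigen \<mu> f" "eigen \<nu> g" "\<mu> \<noteq> \<nu>"
  shows "form f g = 0"
proof -
  have "real \<mu> * form f g = form (lap f) g"
    unfolding form_scale[symmetric] by (rule form_cong) (use assms(1) in \<open>auto simp: eigen_def\<close>)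
  also have "\<dots> = form (lap g) f" using form_lap_symmetric[of f g] form_commute by simp
  also have "\<dots> = form (\<lambda>i. real \<nu> * g i) f"
    by (rule form_cong) (use assms(2) in \<open>auto simp: eigen_def\<close>)
  also have "\<dots> = real \<nu> * form f g" by (simp add: form_scale form_commute)
  finally show ?thesis using assms(3) by simp
qed

text \<open>By symmetry \<open>\<langle>h|h\<rangle> = \<langle>r|(L - \<mu>) h\<rangle> = 0\<close>.\<close>
lemma generalized_eigen:
  assumes "eigen \<mu> h" "\<And>i. i \<in> sizes \<Longrightarrow> lap r i - real \<mu> * r i = h i"
  shows "eigen \<mu> r"
proof -
  have h: "form h g = form (lap r) g - real \<mu> * form r g" for g
  proof -
    have "form h g = form (\<lambda>i. lap r i - real \<mu> * r i) g"
      by (rule form_cong) (use assms(2) in auto)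
    then show ?thesis by (simp add: form_def algebra_simps sum_subtractf sum_distrib_left)
  qed
  have "form (lap r) h = form r (lap h)" by (rule form_lap_symmetric)
  also have "\<dots> = form (\<lambda>i. real \<mu> * h i) r"
    unfolding form_commute[of r] by (rule form_cong) (use assms(1) in \<open>auto simp: eigen_def\<close>)
  finally have "form h h = 0" using h[of h] by (simp add: form_scale form_commute)
  then have "h i = 0" if "i \<in> sizes" for i using that by (rule form_self_zero)
  then show ?thesis using assms(2) by (simp add: eigen_def)
qed

section \<open>Eigenfunctions from binomial coefficients\<close>

lemma real_lam: "j \<le> k \<Longrightarrow> real (lam j) = real j * (real n + 1 - real j)"
  using kn by (simp add: lam_def of_nat_diff)

text \<open>Binomial coefficients in i make the operator bidiagonal with the eigenvalues on the
  diagonal. The reasons are Pascal's rule for the differences and absorption for the factors i and i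
  - j.\<close>

lemma lap_binomial:
  assumes "Suc j \<le> k"
  shows "lap (\<lambda>i. real (i choose Suc j)) i
    = real (lam (Suc j)) * real (i choose Suc j) - (real k - real j)\<^sup>2 * real (i choose j)"
proof -
  define A B where "A = real (i choose Suc j)" and "B = real (i choose j)"
  have 1: "real (i choose Suc j) - real ((i + 1) choose Suc j) = - B" by (simp add: B_def)
  have 2: "real i * (real (i choose Suc j) - real ((i - 1) choose Suc j)) = real (Suc j) * A"
  proof (cases i)
    case (Suc l)
    have "real (Suc l choose Suc j) - real (l choose Suc j) = real (l choose j)" by simp
    moreover have "real (Suc l) * real (l choose j) = real (Suc j) * real (Suc l choose Suc j)"
      by (metis Suc_times_binomial of_nat_mult)
    ultimately show ?thesis using Suc by (simp add: A_def)
  qed (simp add: A_def)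
  have 3: "(real i - real j) * B = real (Suc j) * A"
  proof (cases "j \<le> i")
    case True
    have "(i - j) * (i choose j) = Suc j * (i choose Suc j)"
      by (metis mult.commute binomial_absorption binomial_absorb_comp)
    then have "real (i - j) * B = real (Suc j) * A" unfolding A_def B_def by (metis of_nat_mult)
    then show ?thesis using True by (simp add: of_nat_diff)
  qed (simp add: A_def B_def binomial_eq_0)
  have "lap (\<lambda>i. real (i choose Suc j)) i
      = (real k - real i)\<^sup>2 * (- B) + (real n - 2 * real k + real i) * (real (Suc j) * A)"
    unfolding lap_def 1 2[symmetric] by (simp only: mult_ac)
  \<comment> \<open>Expanding around j leaves a multiple of (i - j) B, which absorption turns into
    A. The coefficients 2k - i - j and n - 2k + i then add up to n - j, free of i.\<close>
  also have "(real k - real i)\<^sup>2 * (- B)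
      = - (real k - real j)\<^sup>2 * B + ((real k - real j) + (real k - real i)) * ((real i - real j) * B)"
    by (simp add: power2_eq_square algebra_simps)
  finally show ?thesis unfolding 3 real_lam[OF assms] A_def[symmetric] B_def[symmetric]
    by (simp add: algebra_simps)
qed

lemma eigen_scale: "eigen \<mu> f \<Longrightarrow> eigen \<mu> (\<lambda>i. c * f i)"
  using lap_linear[of c f 0 f] by (simp add: eigen_def)

lemma lap_const: "lap (\<lambda>_. c) i = 0"
  by (simp add: lap_def)

text \<open>By \<open>lap_binomial\<close>, \<open>lap\<close> - L sends the next binomial to a
  multiple of the previous one, whose components are known. Those with \<mu> \<noteq> L are inverted
  by division; a component at L itself, possible when eigenvalues coincide, would be a Jordan block,
  which \<open>generalized_eigen\<close> excludes.\<close>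

lemma binomial_eigen_decomposition:
  "j \<le> k \<Longrightarrow> \<exists>g. (\<forall>i\<in>sizes. real (i choose j) = (\<Sum>\<mu>\<in>lam ` {..j}. g \<mu> i))
    \<and> (\<forall>\<mu>\<in>lam ` {..j}. eigen \<mu> (g \<mu>))"
proof (induction j)
  case 0
  show ?case
    by (rule exI[of _ "\<lambda>_ _. 1"]) (simp add: eigen_def lap_const lam_def)
next
  case (Suc j)
  define L c \<Lambda> where "L = lam (Suc j)" and "c = (real k - real j)\<^sup>2" and "\<Lambda> = lam ` {..j}"
  from Suc obtain h where h: "\<And>i. i \<in> sizes \<Longrightarrow> real (i choose j) = (\<Sum>\<mu>\<in>\<Lambda>. h \<mu> i)"
    "\<And>\<mu>. \<mu> \<in> \<Lambda> \<Longrightarrow> eigen \<mu> (h \<mu>)" unfolding \<Lambda>_def by auto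
  have fin: "finite \<Lambda>" by (simp add: \<Lambda>_def)
  \<comment> \<open>Chosen so that \<open>lap\<close> - L maps \<open>e \<mu>\<close> to -c times
    \<open>h \<mu>\<close>.\<close>
  define e where "e \<mu> = (\<lambda>i. (- c / (real \<mu> - real L)) * h \<mu> i)" for \<mu>
  define s where "s = (\<lambda>i. \<Sum>\<mu>\<in>\<Lambda> - {L}. e \<mu> i)"
  define r where "r = (\<lambda>i. real (i choose Suc j) - s i)"
  have e: "eigen \<mu> (e \<mu>)" if "\<mu> \<in> \<Lambda>" for \<mu>
    unfolding e_def by (rule eigen_scale[OF h(2)[OF that]])
  have "eigen L (\<lambda>i. if L \<in> \<Lambda> then - c * h L i else 0)"
  proof (cases "L \<in> \<Lambda>")
    case True
    then show ?thesis using eigen_scale[OF h(2)[OF True], of "- c"] by simp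
  qed (simp add: eigen_def lap_const)
  moreover have "lap r i - real L * r i = (if L \<in> \<Lambda> then - c * h L i else 0)" if i: "i \<in> sizes" for i
  proof -
    have "lap s i = (\<Sum>\<mu>\<in>\<Lambda> - {L}. real \<mu> * e \<mu> i)"
      unfolding s_def using e i fin by (subst lap_sum) (auto simp: eigen_def)
    then have "lap s i - real L * s i = (\<Sum>\<mu>\<in>\<Lambda> - {L}. (real \<mu> - real L) * e \<mu> i)"
      by (simp add: s_def sum_distrib_left sum_subtractf algebra_simps)
    also have "\<dots> = (\<Sum>\<mu>\<in>\<Lambda> - {L}. - c * h \<mu> i)"
      by (rule sum.cong) (auto simp: e_def)
    finally have 1: "lap s i - real L * s i = - c * (\<Sum>\<mu>\<in>\<Lambda> - {L}. h \<mu> i)"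
      by (simp add: sum_distrib_left)
    have 2: "lap r i = lap (\<lambda>i. real (i choose Suc j)) i - lap s i"
      using lap_linear[of 1 "\<lambda>i. real (i choose Suc j)" "-1" s i] by (simp add: r_def)
    have 3: "(\<Sum>\<mu>\<in>\<Lambda>. h \<mu> i) = (\<Sum>\<mu>\<in>\<Lambda> - {L}. h \<mu> i) + (if L \<in> \<Lambda> then h L i else 0)"
      using fin by (simp add: sum.remove)
    have "lap r i - real L * r i = - c * real (i choose j) - (lap s i - real L * s i)"
      unfolding 2 lap_binomial[OF Suc.prems] fun_cong[OF r_def] L_def c_def by (simp add: algebra_simps)
    then show ?thesis unfolding 1 h(1)[OF i] 3 by (auto simp: algebra_simps split: if_splits)
  qed
  ultimately have r: "eigen L r" by (rule generalized_eigen)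
  define g where "g \<mu> = (if \<mu> = L then r else e \<mu>)" for \<mu>
  have ins: "lam ` {..Suc j} = insert L (\<Lambda> - {L})"
    by (auto simp: L_def \<Lambda>_def atMost_Suc)
  have "(\<Sum>\<mu>\<in>lam ` {..Suc j}. g \<mu> i) = real (i choose Suc j)" for i
  proof -
    have "(\<Sum>\<mu>\<in>lam ` {..Suc j}. g \<mu> i) = g L i + (\<Sum>\<mu>\<in>\<Lambda> - {L}. g \<mu> i)"
      unfolding ins using fin by (subst sum.insert) auto
    also have "(\<Sum>\<mu>\<in>\<Lambda> - {L}. g \<mu> i) = s i" unfolding s_def by (rule sum.cong) (auto simp: g_def)
    finally show ?thesis by (simp add: g_def r_def)
  qed
  moreover have "eigen \<mu> (g \<mu>)" if "\<mu> \<in> lam ` {..Suc j}" for \<mu>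
    using that r e unfolding ins by (auto simp: g_def)
  ultimately show ?case by metis
qed

section \<open>Growth of the spectral weights\<close>

lemma lam_strict_mono:
  assumes "2 * k \<le> n" "i < j" "j \<le> k"
  shows "lam i < lam j"
proof -
  have "real (lam j) - real (lam i) = (real j - real i) * (real n + 1 - real i - real j)"
    using assms by (simp add: real_lam algebra_simps)
  moreover have "0 < (real j - real i) * (real n + 1 - real i - real j)"
    by (rule mult_pos_pos) (use assms in auto)
  ultimately show ?thesis by linarith
qed

text \<open>On the left is the product of the operators lam(l) - \<open>lap\<close> over the top d
  indices, applied componentwise. By \<open>lap_binomial\<close> each factor lowers the binomial
  from l to l - 1 and contributes (k-l+1)^2, in total the square of d!.\<close>

lemma filtered_decomposition:
  assumes g: "\<And>i. i \<in> sizes \<Longrightarrow> real (i choose k) = (\<Sum>\<mu>\<in>lam ` {..k}. g \<mu> i)"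
    "\<And>\<mu>. \<mu> \<in> lam ` {..k} \<Longrightarrow> eigen \<mu> (g \<mu>)"
    and "d \<le> k" "i \<in> sizes"
  shows "(\<Sum>\<mu>\<in>lam ` {..k}. (\<Prod>l\<in>{k - d<..k}. real (lam l) - real \<mu>) * g \<mu> i)
    = (fact d)\<^sup>2 * real (i choose (k - d))"
  using assms(3,4)
proof (induction d arbitrary: i)
  case 0
  then show ?case using g(1)[of i] by simp
next
  case (Suc d)
  define j where "j = k - Suc d"
  have j: "k - d = Suc j" "Suc j \<le> k" "{j<..k} = insert (Suc j) {Suc j<..k}" using Suc.prems by (auto simp: j_def)
  have jd: "real k - real j = real (Suc d)" using Suc.prems by (simp add: j_def of_nat_diff)
  define P where "P \<mu> = (\<Prod>l\<in>{Suc j<..k}. real (lam l) - real \<mu>)" for \<mu>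
  define G where "G = (\<lambda>i. \<Sum>\<mu>\<in>lam ` {..k}. P \<mu> * g \<mu> i)"
  have IH: "G i = (fact d)\<^sup>2 * real (i choose Suc j)" if "i \<in> sizes" for i
    using Suc.IH[OF _ that] Suc.prems by (simp add: G_def P_def j)
  have "lap G i = (\<Sum>\<mu>\<in>lam ` {..k}. real \<mu> * (P \<mu> * g \<mu> i))"
  proof -
    have "lap G i = (\<Sum>\<mu>\<in>lam ` {..k}. lap (\<lambda>i. P \<mu> * g \<mu> i) i)"
      unfolding G_def by (rule lap_sum) simp
    also have "\<dots> = (\<Sum>\<mu>\<in>lam ` {..k}. real \<mu> * (P \<mu> * g \<mu> i))"
      by (rule sum.cong) (use eigen_scale[OF g(2)] Suc.prems in \<open>auto simp: eigen_def\<close>)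
    finally show ?thesis .
  qed
  moreover have "lap G i = lap (\<lambda>i. (fact d)\<^sup>2 * real (i choose Suc j)) i"
    by (rule lap_cong[OF IH]) (use Suc.prems in auto)
  moreover have "lap (\<lambda>i. (fact d)\<^sup>2 * real (i choose Suc j)) i
      = (fact d)\<^sup>2 * (real (lam (Suc j)) * real (i choose Suc j) - (real (Suc d))\<^sup>2 * real (i choose j))"
    using lap_linear[of "(fact d)\<^sup>2" "\<lambda>i. real (i choose Suc j)" 0 "\<lambda>_. 0" i]
    by (simp add: lap_binomial[OF j(2)] jd)
  ultimately have "(\<Sum>\<mu>\<in>lam ` {..k}. real \<mu> * (P \<mu> * g \<mu> i))
      = real (lam (Suc j)) * G i - (fact d)\<^sup>2 * (real (Suc d))\<^sup>2 * real (i choose j)"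
    using IH[of i] Suc.prems by (simp add: algebra_simps)
  moreover have "(\<Sum>\<mu>\<in>lam ` {..k}. (\<Prod>l\<in>{j<..k}. real (lam l) - real \<mu>) * g \<mu> i)
      = real (lam (Suc j)) * G i - (\<Sum>\<mu>\<in>lam ` {..k}. real \<mu> * (P \<mu> * g \<mu> i))"
    unfolding j(3) G_def P_def by (simp add: sum_distrib_left sum_subtractf algebra_simps)
  ultimately show ?case unfolding j_def[symmetric] by (simp add: power_mult_distrib)
qed

text \<open>Markov's inequality. Filtering out the indices above M gives the total mass c of the
  weights D(i) P(i); filtering out M too gives the mean of the gap lam(M) - lam(i), namely (k-M+1)M
  \<le> k^2. The gap is at least n+2-2M for i < M, so n \<ge> 4k^2+2k leaves at most c/4 below M. As
  D(i) \<ge> D(M) there, the estimate passes to P.\<close>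

lemma top_weight_dominates:
  assumes g: "\<And>i. i \<in> sizes \<Longrightarrow> real (i choose k) = (\<Sum>\<mu>\<in>lam ` {..k}. g \<mu> i)"
    "\<And>\<mu>. \<mu> \<in> lam ` {..k} \<Longrightarrow> eigen \<mu> (g \<mu>)"
    and pos: "\<And>\<mu>. \<mu> \<in> lam ` {..k} \<Longrightarrow> g \<mu> k \<ge> 0"
    and n: "4 * k * k + 2 * k \<le> n" and M: "1 \<le> M" "M \<le> k"
  shows "3 * (\<Sum>i<M. g (lam i) k) \<le> g (lam M) k"
proof -
  define P where "P i = g (lam i) k" for i
  define D where "D i = (\<Prod>l\<in>{M<..k}. real (lam l) - real (lam i))" for i
  define c where "c = (fact (k - M))\<^sup>2 * real (k choose M)"
  have n2: "2 * k \<le> n" using n by linarith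
  have mono: "i < j \<Longrightarrow> j \<le> k \<Longrightarrow> real (lam i) < real (lam j)" for i j
    using lam_strict_mono[OF n2] by simp
  have inj: "inj_on lam {..k}"
  proof (rule inj_onI)
    fix i j assume "i \<in> {..k}" "j \<in> {..k}" "lam i = lam j"
    then show "i = j" using lam_strict_mono[OF n2, of i j] lam_strict_mono[OF n2, of j i]
      by (metis atMost_iff less_irrefl linorder_neqE_nat)
  qed
  have filt: "(\<Sum>i\<le>k. (\<Prod>l\<in>{j<..k}. real (lam l) - real (lam i)) * P i)
      = (fact (k - j))\<^sup>2 * real (k choose j)" if "j \<le> k" for j
    using filtered_decomposition[OF g, of "k - j" k] that top_size
    by (simp add: sum.reindex[OF inj] P_def)
  have vanish: "(\<Sum>i\<le>k. (\<Prod>l\<in>{j<..k}. real (lam l) - real (lam i)) * P i)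
      = (\<Sum>i\<le>j. (\<Prod>l\<in>{j<..k}. real (lam l) - real (lam i)) * P i)" if "j \<le> k" for j
  proof (rule sum.mono_neutral_right)
    show "\<forall>i\<in>{..k} - {..j}. (\<Prod>l\<in>{j<..k}. real (lam l) - real (lam i)) * P i = 0"
      by (auto intro!: prod_zero)
  qed (use that in auto)
  define S where "S = (\<Sum>i<M. D i * P i)"
  have P0: "P i \<ge> 0" if "i \<le> k" for i using pos that by (simp add: P_def)
  have D0: "D i > 0" if "i \<le> M" for i
    unfolding D_def by (rule prod_pos) (use that mono in auto)
  have DM: "D M \<le> D i" if "i < M" for i
    unfolding D_def by (rule prod_mono) (use that M mono[of i M] mono[of M] in \<open>auto simp: less_imp_le\<close>)
  have e1: "D M * P M + S = c"
    using vanish[OF M(2)] filt[OF M(2)] by (simp add: c_def S_def D_def flip: lessThan_Suc_atMost)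
  obtain M' where M': "M = Suc M'" using M by (cases M) auto
  have ins: "{M'<..k} = insert M {M<..k}" using M M' by auto
  have e2: "(\<Sum>i<M. (real (lam M) - real (lam i)) * (D i * P i)) = c * (real (k - M') * real M)"
  proof -
    have "(\<Sum>i<M. (real (lam M) - real (lam i)) * (D i * P i)) = (fact (k - M'))\<^sup>2 * real (k choose M')"
      using vanish[of M'] filt[of M'] M M'
      by (simp add: ins D_def mult.assoc flip: lessThan_Suc_atMost)
    also have "\<dots> = (fact (k - M))\<^sup>2 * real (k - M') * (real (k - M') * real (k choose M'))"
    proof -
      have "k - M' = Suc (k - M)" using M M' by simp
      then show ?thesis by (simp only: fact_Suc power2_eq_square) (simp add: algebra_simps)
    qed
    also have "real (k - M') * real (k choose M') = real M * real (k choose M)"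
      unfolding M' by (metis of_nat_mult mult.commute binomial_absorption binomial_absorb_comp)
    finally show ?thesis by (simp add: c_def mult_ac)
  qed
  have km: "real (k - M') * real M > 0" using M M' by simp
  have gap: "4 * (real (k - M') * real M) \<le> real (lam M) - real (lam i)" if "i < M" for i
  proof -
    have "lam i \<le> lam M'" using that M' M lam_strict_mono[OF n2, of i M'] by (cases "i = M'") auto
    moreover have "real (lam M) - real (lam M') = real n + 2 - 2 * real M"
      using M M' by (simp add: real_lam algebra_simps)
    moreover have "(k - M') * M \<le> k * k" using M by (intro mult_mono) auto
    then have "real (k - M') * real M \<le> real (k * k)" by (simp only: of_nat_le_iff flip: of_nat_mult)
    moreover have "real n \<ge> 4 * real (k * k) + 2 * real k"
      using n by (simp flip: of_nat_mult of_nat_add of_nat_le_iff add: mult.assoc)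
    ultimately show ?thesis using M by linarith
  qed
  have "(\<Sum>i<M. 4 * (real (k - M') * real M) * (D i * P i)) \<le> c * (real (k - M') * real M)"
    unfolding e2[symmetric]
    by (rule sum_mono, rule mult_right_mono[OF gap])
       (use P0 less_imp_le[OF D0] M in \<open>auto intro!: mult_nonneg_nonneg\<close>)
  then have "4 * S * (real (k - M') * real M) \<le> c * (real (k - M') * real M)"
    by (simp add: S_def sum_distrib_left sum_distrib_right mult_ac)
  then have "4 * S \<le> c" by (rule mult_right_le_imp_le[OF _ km])
  then have "3 * S \<le> D M * P M" using e1 by linarith
  moreover have "D M * (\<Sum>i<M. P i) \<le> S"
    unfolding S_def sum_distrib_left
    by (rule sum_mono, rule mult_right_mono) (use DM P0 M in auto)
  ultimately have "D M * (3 * (\<Sum>i<M. P i)) \<le> D M * P M" by linarith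
  then show ?thesis using D0[of M] by (simp add: P_def)
qed

section \<open>Eigencomponents of the marked vertex\<close>

lemma weight_total: "(\<Sum>i\<le>k. weight i) = real (n choose k)"
proof -
  have "(\<Sum>i\<le>k. (k choose i) * ((n - k) choose (k - i))) = (k + (n - k)) choose k"
    by (rule vandermonde)
  then have "real (\<Sum>i\<le>k. (k choose i) * ((n - k) choose (k - i))) = real (n choose k)"
    using kn by simp
  then show ?thesis by (simp add: weight_def)
qed

text \<open>The Dirichlet form of f with itself vanishes, so neighbouring values agree, and
  \<open>sizes\<close> is an interval ending at k.\<close>

lemma eigen_zero_const:
  assumes "eigen 0 f" "i \<in> sizes"
  shows "f i = f k"
proof -
  have "form (lap f) f = form (\<lambda>_. 0) f"
    by (rule form_cong) (use assms(1) in \<open>auto simp: eigen_def\<close>)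
  then have "(\<Sum>i<k. weight i * (real k - real i)\<^sup>2 * ((f i - f (i + 1)) * (f i - f (i + 1)))) = 0"
    unfolding form_lap by (simp add: form_def)
  then have all: "\<forall>i\<in>{..<k}. weight i * (real k - real i)\<^sup>2 * ((f i - f (i + 1)) * (f i - f (i + 1))) = 0"
    by (subst (asm) sum_nonneg_eq_0_iff) (auto simp: weight_def)
  have next_eq: "f i = f (Suc i)" if "i < k" "i \<in> sizes" for i
    using bspec[OF all, of i] that weight_pos[OF that(2)] by simp
  have "i \<le> k" using assms(2) by (simp add: sizes_def)
  then show ?thesis using assms(2)
  proof (induction rule: inc_induct)
    case (step l)
    then show ?case using next_eq[of l] by (auto simp: sizes_def)
  qed simp
qed

text \<open>For i \<le> k the function i choose k is the indicator of i = k, and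
  \<open>weight\<close> is 1 there, so pairing with it evaluates at k. Orthogonality then gives
  g(\<mu>)(k) = |g(\<mu>)|^2, which yields nonnegativity and the vanishing of components of weight
  0.\<close>

lemma eigen_decomposition:
  obtains g where
    "\<And>i. i \<in> sizes \<Longrightarrow> (\<Sum>\<mu>\<in>lam ` {..k}. g \<mu> i) = (if i = k then 1 else 0)"
    "\<And>\<mu>. \<mu> \<in> lam ` {..k} \<Longrightarrow> eigen \<mu> (g \<mu>)"
    "\<And>\<mu>. \<mu> \<in> lam ` {..k} \<Longrightarrow> g \<mu> k \<ge> 0"
    "\<And>\<mu> i. \<mu> \<in> lam ` {..k} \<Longrightarrow> g \<mu> k = 0 \<Longrightarrow> i \<in> sizes \<Longrightarrow> g \<mu> i = 0"
    "\<And>i. i \<in> sizes \<Longrightarrow> g 0 i = 1 / real (n choose k)"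
    "\<And>M. 4 * k * k + 2 * k \<le> n \<Longrightarrow> 1 \<le> M \<Longrightarrow> M \<le> k
      \<Longrightarrow> 3 * (\<Sum>i<M. g (lam i) k) \<le> g (lam M) k"
proof -
  obtain g where g: "\<And>i. i \<in> sizes \<Longrightarrow> real (i choose k) = (\<Sum>\<mu>\<in>lam ` {..k}. g \<mu> i)"
    "\<And>\<mu>. \<mu> \<in> lam ` {..k} \<Longrightarrow> eigen \<mu> (g \<mu>)"
    using binomial_eigen_decomposition[of k] by auto
  have at_top: "form (\<lambda>i. \<Sum>\<mu>\<in>lam ` {..k}. g \<mu> i) f = f k" for f
  proof -
    have "form (\<lambda>i. \<Sum>\<mu>\<in>lam ` {..k}. g \<mu> i) f = form (\<lambda>i. real (i choose k)) f"
      by (rule form_cong) (simp_all add: g(1))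
    also have "\<dots> = (\<Sum>i<k. weight i * real (i choose k) * f i) + f k"
      by (simp add: form_def weight_def flip: lessThan_Suc_atMost)
    also have "(\<Sum>i<k. weight i * real (i choose k) * f i) = 0"
      by (rule sum.neutral) simp
    finally show ?thesis by simp
  qed
  have norm: "form (g \<mu>) (g \<mu>) = g \<mu> k" if "\<mu> \<in> lam ` {..k}" for \<mu>
  proof -
    have "g \<mu> k = (\<Sum>\<nu>\<in>lam ` {..k}. form (g \<nu>) (g \<mu>))"
      using at_top[of "g \<mu>"] unfolding form_sum by simp
    also have "\<dots> = (\<Sum>\<nu>\<in>lam ` {..k}. if \<nu> = \<mu> then form (g \<mu>) (g \<mu>) else 0)"
      by (rule sum.cong) (simp_all add: eigen_orthogonal[OF g(2) g(2)[OF that]])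
    finally show ?thesis using that by simp
  qed
  have pos: "g \<mu> k \<ge> 0" if "\<mu> \<in> lam ` {..k}" for \<mu>
    using norm[OF that] form_self_nonneg by metis
  have z: "0 \<in> lam ` {..k}" by (rule image_eqI[of _ _ 0]) (simp_all add: lam_def)
  have const: "g 0 i = g 0 k" if "i \<in> sizes" for i by (rule eigen_zero_const[OF g(2)[OF z] that])
  have "form (g 0) (g 0) = form (\<lambda>_. g 0 k) (\<lambda>_. g 0 k)"
    by (rule form_cong) (use const in blast)+
  also have "\<dots> = g 0 k * g 0 k * (\<Sum>i\<le>k. weight i)"
    by (simp add: form_def sum_distrib_left mult_ac)
  \<comment> \<open>Leaves only 0 and 1/N for the constant component; 0 would make the indicator of
    the marked vertex orthogonal to the constants.\<close>
  finally have quad: "g 0 k = g 0 k * g 0 k * real (n choose k)" unfolding norm[OF z] weight_total .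
  have "g 0 k \<noteq> 0"
  proof
    assume "g 0 k = 0"
    then have g0: "g 0 i = 0" if "i \<in> sizes" for i using const that by simp
    have "1 = form (\<lambda>i. \<Sum>\<mu>\<in>lam ` {..k}. g \<mu> i) (\<lambda>_. 1)" by (simp add: at_top)
    also have "\<dots> = (\<Sum>\<mu>\<in>lam ` {..k}. form (g \<mu>) (\<lambda>_. 1))" by (rule form_sum)
    also have "\<dots> = 0"
    proof (rule sum.neutral, rule ballI)
      fix \<mu> assume \<mu>: "\<mu> \<in> lam ` {..k}"
      show "form (g \<mu>) (\<lambda>_. 1) = 0"
      proof (cases "\<mu> = 0")
        case True
        have "form (g \<mu>) (\<lambda>_. 1) = form (\<lambda>_. 0) (\<lambda>_. 1)"
          by (rule form_cong) (simp_all add: True g0)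
        then show ?thesis by (simp add: form_def)
      next
        case False
        then show ?thesis
          by (intro eigen_orthogonal[OF g(2)[OF \<mu>], of 0]) (simp_all add: eigen_def lap_const)
      qed
    qed
    finally show False by simp
  qed
  then have "g 0 k * real (n choose k) = 1" using quad by simp
  then have p0: "g 0 i = 1 / real (n choose k)" if "i \<in> sizes" for i
    using const[OF that] kn by (simp add: field_simps)
  show ?thesis
  proof (rule that[OF _ g(2) pos _ p0 top_weight_dominates[OF g pos]])
    show "(\<Sum>\<mu>\<in>lam ` {..k}. g \<mu> i) = (if i = k then 1 else 0)" if "i \<in> sizes" for i
      using that by (auto simp: sizes_def simp flip: g(1))
    show "g \<mu> i = 0" if "\<mu> \<in> lam ` {..k}" "g \<mu> k = 0" "i \<in> sizes" for \<mu> i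
      using form_self_zero[OF _ that(3), of "g \<mu>"] norm[OF that(1)] that(2) by simp
  qed
qed

end

subsection \<open>Matrix exponentials and the Johnson Laplacian\<close>

lemma mapply_mmult:
  assumes "finite V"
  shows "mapply V (mmult V A B) x = mapply V A (mapply V B x)"
proof
  fix i
  have "mapply V (mmult V A B) x i = (\<Sum>j\<in>V. \<Sum>l\<in>V. A i l * B l j * x j)"
    by (simp add: mapply_def mmult_def sum_distrib_right)
  also have "\<dots> = (\<Sum>l\<in>V. \<Sum>j\<in>V. A i l * B l j * x j)" by (rule sum.swap)
  also have "\<dots> = mapply V A (mapply V B x) i"
    by (simp add: mapply_def sum_distrib_left mult.assoc)
  finally show "mapply V (mmult V A B) x i = mapply V A (mapply V B x) i" .
qed

lemma mpow_eigen:
  assumes "finite V" "\<And>i. i \<in> V \<Longrightarrow> mapply V A x i = \<alpha> * x i" "i \<in> V"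
  shows "mapply V (mpow V A r) x i = \<alpha> ^ r * x i"
  using assms(3)
proof (induction r arbitrary: i)
  case 0
  then show ?case using assms(1) by (simp add: mapply_def mident_def if_distrib[of "\<lambda>z. z * _"] cong: if_cong)
next
  case (Suc r)
  have "mapply V (mpow V A (Suc r)) x i = mapply V A (mapply V (mpow V A r) x) i"
    by (simp add: mapply_mmult[OF assms(1)])
  also have "\<dots> = mapply V A (\<lambda>j. \<alpha> ^ r * x j) i"
    unfolding mapply_def[of V A] using Suc.IH by (intro sum.cong) auto
  also have "\<dots> = \<alpha> ^ r * mapply V A x i"
    by (simp add: mapply_def sum_distrib_left mult_ac)
  finally show ?case using assms(2)[OF Suc.prems] by simp
qed

lemma summable_mpow:
  assumes V: "finite V" and ij: "i \<in> V" "j \<in> V"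
  shows "summable (\<lambda>r. mpow V A r i j / of_nat (fact r))"
proof -
  define B where "B = (\<Sum>i\<in>V. \<Sum>l\<in>V. cmod (A i l))"
  have row: "(\<Sum>l\<in>V. cmod (A i l)) \<le> B" if "i \<in> V" for i
    unfolding B_def by (rule member_le_sum[OF that]) (auto simp: V sum_nonneg)
  have B0: "B \<ge> 0" unfolding B_def by (simp add: sum_nonneg)
  have bound: "cmod (mpow V A r i j) \<le> B ^ r" if "i \<in> V" for r i
    using that
  proof (induction r arbitrary: i)
    case 0
    then show ?case by (simp add: mident_def)
  next
    case (Suc r)
    have "cmod (mpow V A (Suc r) i j) \<le> (\<Sum>l\<in>V. cmod (A i l * mpow V A r l j))"
      by (simp add: mmult_def norm_sum)
    also have "\<dots> \<le> (\<Sum>l\<in>V. cmod (A i l) * B ^ r)"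
      by (intro sum_mono) (simp add: norm_mult mult_left_mono Suc.IH)
    also have "\<dots> \<le> B * B ^ r"
      unfolding sum_distrib_right[symmetric] using row[OF Suc.prems] B0 by (intro mult_right_mono) auto
    finally show ?case by simp
  qed
  show ?thesis
  proof (rule summable_comparison_test'[where N = 0])
    show "summable (\<lambda>r. inverse (fact r) * B ^ r)" by (rule summable_exp)
    show "norm (mpow V A r i j / of_nat (fact r)) \<le> inverse (fact r) * B ^ r" for r
      using bound[OF ij(1)] by (simp add: norm_divide field_simps)
  qed
qed

text \<open>Both operators of the algorithm are evaluated through eigenvectors: the walk on radial
  eigenfunctions, the search operator on |m> and on vectors vanishing at m.\<close>

lemma mexp_eigen:
  assumes V: "finite V" and eig: "\<And>i. i \<in> V \<Longrightarrow> mapply V A x i = \<alpha> * x i" and i: "i \<in> V"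
  shows "mapply V (mexp V A) x i = exp \<alpha> * x i"
proof -
  have "mapply V (mexp V A) x i = (\<Sum>j\<in>V. \<Sum>r. mpow V A r i j / of_nat (fact r) * x j)"
    unfolding mapply_def mexp_def
    by (intro sum.cong HOL.refl suminf_mult2 summable_mpow[OF V i])
  also have "\<dots> = (\<Sum>r. \<Sum>j\<in>V. mpow V A r i j / of_nat (fact r) * x j)"
    by (rule suminf_sum[symmetric]) (intro summable_mult2 summable_mpow[OF V i])
  also have "\<dots> = (\<Sum>r. \<alpha> ^ r /\<^sub>R fact r * x i)"
  proof (rule suminf_cong)
    fix r
    have "(\<Sum>j\<in>V. mpow V A r i j / of_nat (fact r) * x j) = mapply V (mpow V A r) x i / of_nat (fact r)"
      by (simp add: mapply_def sum_divide_distrib)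
    then show "(\<Sum>j\<in>V. mpow V A r i j / of_nat (fact r) * x j) = \<alpha> ^ r /\<^sub>R fact r * x i"
      using mpow_eigen[OF V eig i] by (simp add: scaleR_conv_of_real divide_inverse mult_ac)
  qed
  also have "\<dots> = exp \<alpha> * x i"
    unfolding exp_def by (intro suminf_mult2[symmetric] summable_exp_generic)
  finally show ?thesis .
qed

lemma mapply_add: "mapply V A (\<lambda>v. x v + y v) i = mapply V A x i + mapply V A y i"
  by (simp add: mapply_def sum.distrib algebra_simps)

lemma mapply_sum: "mapply V A (\<lambda>v. \<Sum>\<mu>\<in>B. c \<mu> * f \<mu> v) i = (\<Sum>\<mu>\<in>B. c \<mu> * mapply V A (f \<mu>) i)"
proof -
  have "mapply V A (\<lambda>v. \<Sum>\<mu>\<in>B. c \<mu> * f \<mu> v) i = (\<Sum>v\<in>V. \<Sum>\<mu>\<in>B. c \<mu> * (A i v * f \<mu> v))"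
    by (simp add: mapply_def sum_distrib_left mult_ac)
  also have "\<dots> = (\<Sum>\<mu>\<in>B. \<Sum>v\<in>V. c \<mu> * (A i v * f \<mu> v))" by (rule sum.swap)
  finally show ?thesis by (simp add: mapply_def sum_distrib_left)
qed

lemma mapply_cong: "(\<And>v. v \<in> V \<Longrightarrow> x v = y v) \<Longrightarrow> mapply V A x = mapply V A y"
  by (auto simp: mapply_def fun_eq_iff intro!: sum.cong)

section \<open>Search operator and Laplacian on the vertex set\<close>

lemma finite_johnson_vertices: "finite (johnson_vertices n k)"
  by (rule finite_subset[of _ "Pow {1..n}"]) (auto simp: johnson_vertices_def)

lemma card_johnson_vertices: "card (johnson_vertices n k) = n choose k"
  unfolding johnson_vertices_def using n_subsets[of "{1..n}" k] by simp

lemma search_op_apply: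
  assumes m: "m \<in> johnson_vertices n k" and v: "v \<in> johnson_vertices n k"
  shows "mapply (johnson_vertices n k) (search_op n k m \<theta>) x v
    = x v + (cis (- \<theta>) - 1) * x m * basis_state m v"
proof -
  let ?V = "johnson_vertices n k"
  let ?A = "\<lambda>u v. - \<i> * complex_of_real \<theta> * proj m u v"
  have V: "finite ?V" by (rule finite_johnson_vertices)
  have A: "mapply ?V ?A y i = - \<i> * \<theta> * (if i = m then y m else 0)" for y i
    using m V by (simp add: mapply_def proj_def if_distrib[of "\<lambda>z. z * _"] if_distrib[of "\<lambda>z. _ * z"] cong: if_cong)
  define y z where "y = (\<lambda>v. if v = m then 0 else x v)" and "z = (\<lambda>v. x m * basis_state m v)"
  have x: "x = (\<lambda>v. y v + z v)" by (auto simp: y_def z_def basis_state_def)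
  have 1: "mapply ?V (mexp ?V ?A) y v = exp 0 * y v"
    by (rule mexp_eigen[OF V _ v]) (simp only: A, simp add: y_def)
  have 2: "mapply ?V (mexp ?V ?A) z v = exp (- \<i> * \<theta>) * z v"
    by (rule mexp_eigen[OF V _ v]) (simp only: A, simp add: z_def basis_state_def)
  have "exp (- \<i> * \<theta>) = cis (- \<theta>)" by (simp add: cis_conv_exp)
  then show ?thesis
    unfolding search_op_def by (subst x, subst mapply_add)
      (simp only: 1 2, auto simp: y_def z_def basis_state_def algebra_simps)
qed

text \<open>A neighbour of v arises from a unique exchange of some a in v for some b outside. Since
  k \<ge> 1, the truncated k - 1 in \<open>johnson_adj\<close> differs from k, so v is not its own
  neighbour.\<close>

lemma sum_johnson_neighbours:
  fixes F :: "nat set \<Rightarrow> real"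
  assumes k: "k \<ge> 1" and v: "v \<in> johnson_vertices n k"
  shows "(\<Sum>w | w \<in> johnson_vertices n k \<and> johnson_adj k v w. F w)
    = (\<Sum>(a,b)\<in>v \<times> ({1..n} - v). F (insert b (v - {a})))"
proof -
  have fv: "finite v" and cv: "card v = k" and vn: "v \<subseteq> {1..n}"
    using v by (auto simp: johnson_vertices_def intro: finite_subset)
  have "bij_betw (\<lambda>p. insert (snd p) (v - {fst p})) (v \<times> ({1..n} - v))
      {w. w \<in> johnson_vertices n k \<and> johnson_adj k v w}"
    unfolding bij_betw_def
  proof
    show "inj_on (\<lambda>p. insert (snd p) (v - {fst p})) (v \<times> ({1..n} - v))"
      by (rule inj_onI) (auto simp: set_eq_iff, metis+)
    show "(\<lambda>p. insert (snd p) (v - {fst p})) ` (v \<times> ({1..n} - v))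
        = {w. w \<in> johnson_vertices n k \<and> johnson_adj k v w}"
    proof (intro set_eqI iffI)
      fix w assume "w \<in> (\<lambda>p. insert (snd p) (v - {fst p})) ` (v \<times> ({1..n} - v))"
      then obtain a b where w: "w = insert b (v - {a})" "a \<in> v" "b \<in> {1..n}" "b \<notin> v" by auto
      have "card w = k" using w fv cv k by (simp add: card_insert_if card_Diff_singleton)
      moreover have "v \<inter> w = v - {a}" using w by auto
      then have "card (v \<inter> w) = k - 1" using w fv cv by simp
      ultimately show "w \<in> {w. w \<in> johnson_vertices n k \<and> johnson_adj k v w}"
        using w vn by (auto simp: johnson_vertices_def johnson_adj_def)
    next
      fix w assume "w \<in> {w. w \<in> johnson_vertices n k \<and> johnson_adj k v w}"
      then have w: "w \<subseteq> {1..n}" "card w = k" "card (v \<inter> w) = k - 1"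
        by (auto simp: johnson_vertices_def johnson_adj_def)
      have fw: "finite w" using w(1) by (rule finite_subset) simp
      have "card (v - w) = 1" "card (w - v) = 1"
        using card_Diff_subset_Int[of v w] card_Diff_subset_Int[of w v] fv fw cv w k
        by (simp_all add: Int_commute)
      then obtain a b where ab: "v - w = {a}" "w - v = {b}" by (auto simp: card_1_singleton_iff)
      then have "w = insert b (v - {a})" "a \<in> v" "b \<in> {1..n} - v" using w(1) by auto
      then show "w \<in> (\<lambda>p. insert (snd p) (v - {fst p})) ` (v \<times> ({1..n} - v))"
        by (intro image_eqI[of _ _ "(a, b)"]) auto
    qed
  qed
  from sum.reindex_bij_betw[OF this, of F] show ?thesis by (simp add: case_prod_unfold)
qed

text \<open>An exchange of a for b changes the intersection with m only if exactly one of a and b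
  lies in m; counting these exchanges gives the two terms of \<open>lap\<close>.\<close>

lemma laplacian_radial:
  assumes k: "k \<ge> 1" and m: "m \<in> johnson_vertices n k" and v: "v \<in> johnson_vertices n k"
  shows "mapply (johnson_vertices n k) (johnson_laplacian n k) (\<lambda>w. of_real (f (card (m \<inter> w)))) v
    = of_real (johnson_radial.lap n k f (card (m \<inter> v)))"
proof -
  let ?V = "johnson_vertices n k"
  have V: "finite ?V" by (rule finite_johnson_vertices)
  have fv: "finite v" "card v = k" "v \<subseteq> {1..n}" and fm: "finite m" "card m = k" "m \<subseteq> {1..n}"
    using v m by (auto simp: johnson_vertices_def intro: finite_subset)
  define i where "i = card (m \<inter> v)"
  have "card v \<le> n" using card_mono[OF _ fv(3)] by simp
  then have kn: "k \<le> n" using fv(2) by simp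
  then interpret johnson_radial n k by unfold_locales
  define Nb where "Nb = {w. w \<in> ?V \<and> johnson_adj k v w}"
  have fN: "finite Nb" using V by (simp add: Nb_def)
  have "mapply ?V (johnson_laplacian n k) (\<lambda>w. of_real (f (card (m \<inter> w)))) v
      = (\<Sum>w\<in>?V. (if v = w then of_nat (card Nb) * complex_of_real (f (card (m \<inter> w))) else 0)
          - (if johnson_adj k v w then complex_of_real (f (card (m \<inter> w))) else 0))"
    unfolding mapply_def johnson_laplacian_def Nb_def by (rule sum.cong) (auto simp: algebra_simps)
  also have "\<dots> = of_nat (card Nb) * complex_of_real (f i) - (\<Sum>w\<in>Nb. complex_of_real (f (card (m \<inter> w))))"
    unfolding sum_subtractf using V v by (simp add: i_def Nb_def sum.inter_filter)
  also have "\<dots> = of_real (\<Sum>w\<in>Nb. f i - f (card (m \<inter> w)))"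
    by (simp add: sum_subtractf)
  also have "(\<Sum>w\<in>Nb. f i - f (card (m \<inter> w)))
      = (\<Sum>(a,b)\<in>v \<times> ({1..n} - v). f i - f (card (m \<inter> insert b (v - {a}))))"
    unfolding Nb_def by (rule sum_johnson_neighbours[OF k v])
  also have "\<dots> = (\<Sum>a\<in>v. \<Sum>b\<in>{1..n} - v. f i - f (card (m \<inter> insert b (v - {a}))))"
    by (rule sum.cartesian_product[symmetric])
  also have "\<dots> = (\<Sum>a\<in>v. if a \<in> m then real (n - (2 * k - i)) * (f i - f (i - 1)) else real (k - i) * (f i - f (i + 1)))"
  proof (rule sum.cong[OF HOL.refl])
    fix a assume a: "a \<in> v"
    have split: "{1..n} - v = (m - v) \<union> ({1..n} - (m \<union> v))" using fm(3) by auto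
    have cm: "card (m - v) = k - i"
      using card_Diff_subset_Int[of m v] fm by (simp add: i_def)
    have "card (m \<union> v) = 2 * k - i"
      using card_Un_Int[OF fm(1) fv(1)] fm fv by (simp add: i_def)
    then have co: "card ({1..n} - (m \<union> v)) = n - (2 * k - i)"
      using fm fv by (subst card_Diff_subset) auto
    have c: "card (m \<inter> insert b (v - {a})) = (if a \<in> m then (if b \<in> m then i else i - 1) else (if b \<in> m then i + 1 else i))"
      if "b \<notin> v" for b
    proof -
      have "m \<inter> insert b (v - {a}) = (if b \<in> m then insert b (m \<inter> v - {a}) else m \<inter> v - {a})" by auto
      moreover have "card (m \<inter> v - {a}) = (if a \<in> m then i - 1 else i)"
        using a fm by (auto simp: i_def card_Diff_singleton)
      moreover have "b \<notin> m \<inter> v - {a}" using that by auto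
      moreover have "i \<ge> 1" if "a \<in> m"
      proof -
        have "card {a} \<le> i" unfolding i_def by (rule card_mono) (use that a fm in auto)
        then show ?thesis by simp
      qed
      ultimately show ?thesis using fm by (auto simp: card_insert_if)
    qed
    have "(\<Sum>b\<in>{1..n} - v. f i - f (card (m \<inter> insert b (v - {a}))))
      = (\<Sum>b\<in>m - v. f i - f (card (m \<inter> insert b (v - {a}))))
        + (\<Sum>b\<in>{1..n} - (m \<union> v). f i - f (card (m \<inter> insert b (v - {a}))))"
      unfolding split by (rule sum.union_disjoint) (use fm in auto)
    also have "(\<Sum>b\<in>m - v. f i - f (card (m \<inter> insert b (v - {a}))))
      = (\<Sum>b\<in>m - v. if a \<in> m then 0 else f i - f (i + 1))"
      by (rule sum.cong, rule HOL.refl, subst c) auto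
    also have "(\<Sum>b\<in>{1..n} - (m \<union> v). f i - f (card (m \<inter> insert b (v - {a}))))
      = (\<Sum>b\<in>{1..n} - (m \<union> v). if a \<in> m then f i - f (i - 1) else 0)"
      by (rule sum.cong, rule HOL.refl, subst c) auto
    finally show "(\<Sum>b\<in>{1..n} - v. f i - f (card (m \<inter> insert b (v - {a}))))
        = (if a \<in> m then real (n - (2 * k - i)) * (f i - f (i - 1)) else real (k - i) * (f i - f (i + 1)))"
      using cm co by simp
  qed
  also have "\<dots> = real i * (real (n - (2 * k - i)) * (f i - f (i - 1))) + real (k - i) * (real (k - i) * (f i - f (i + 1)))"
  proof -
    have "card (v \<inter> m) = i" by (simp add: i_def Int_commute)
    moreover have "card (v \<inter> - m) = k - i"
      using card_Diff_subset_Int[of v m] fv fm calculation by (simp add: Diff_eq)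
    ultimately show ?thesis by (simp add: sum.If_cases fv(1) Int_def[symmetric] Collect_mem_eq Compl_eq[symmetric])
  qed
  also have "\<dots> = lap f i"
  proof -
    have i: "i \<le> k" unfolding i_def using card_mono[OF fm(1), of "m \<inter> v"] fm(2) by auto
    have "card (m \<union> v) \<le> n" using card_mono[of "{1..n}" "m \<union> v"] fm fv by simp
    then have "2 * k \<le> n + i" using card_Un_Int[OF fm(1) fv(1)] fm fv by (simp add: i_def)
    then have "real (n - (2 * k - i)) = real n - 2 * real k + real i" "real (k - i) = real k - real i"
      using i by (auto simp: of_nat_diff)
    then show ?thesis by (simp add: lap_def power2_eq_square)
  qed
  finally show ?thesis by (simp add: i_def)
qed

subsection \<open>The search algorithm\<close>

context spectral_search
begin

primrec exec :: "(real \<times> real) list \<Rightarrow> (nat \<Rightarrow> complex) \<Rightarrow> nat \<Rightarrow> complex" where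
  "exec [] a = a"
| "exec (s # steps) a = exec steps (walk (snd s) (refl one (fst s) a))"

lemma exec_append: "exec (xs @ ys) a = exec ys (exec xs a)"
  by (induction xs arbitrary: a) simp_all

lemma circuit_exec:
  assumes "circuit T V"
  shows "\<exists>t0 steps. length steps = T \<and> (\<forall>a. V a = exec steps (walk t0 a))"
  using assms
proof induction
  case (circuit_walk t)
  show ?case by (rule exI[of _ t], rule exI[of _ "[]"]) simp
next
  case (circuit_step T U t \<theta>)
  then obtain t0 steps where "length steps = T" "\<And>a. U a = exec steps (walk t0 a)" by blast
  then show ?case
    by (intro exI[of _ t0] exI[of _ "steps @ [(\<theta>, t)]"]) (simp add: exec_append)
qed

lemma reach_reverse:
  assumes "reach T x"
  obtains t0 steps e where "length steps = T" "cmod e = 1" "exec steps (walk t0 x) = (\<lambda>\<mu>. e * one \<mu>)"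
proof -
  from assms obtain U e where U: "circuit T U" "cmod e = 1" "U one = (\<lambda>\<mu>. e * x \<mu>)"
    by (auto simp: reach_def)
  obtain V where V: "circuit T V" "\<And>a. V (U a) = a" using circuit_inverse[OF U(1)] by auto
  have e: "cnj e * e = 1" using U(2) by (rule unit_cnj_mult)
  have "x = (\<lambda>\<mu>. cnj e * U one \<mu>)" unfolding U(3) mult.assoc[symmetric] e by simp
  then have "V x = (\<lambda>\<mu>. cnj e * one \<mu>)" using circuit_scale[OF V(1), of "cnj e" "U one"] V(2) by simp
  moreover obtain t0 steps where "length steps = T" "\<And>a. V a = exec steps (walk t0 a)"
    using circuit_exec[OF V(1)] by blast
  ultimately show ?thesis using that[of steps "cnj e" t0] U(2) by simp
qed

end

lemma walk_op_eigen:
  assumes "k \<ge> 1" "k \<le> n" "m \<in> johnson_vertices n k" "v \<in> johnson_vertices n k"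
    and eig: "johnson_radial.eigen n k \<mu> f"
    and sizes: "\<And>w. w \<in> johnson_vertices n k \<Longrightarrow> card (m \<inter> w) \<in> johnson_radial.sizes n k"
  shows "mapply (johnson_vertices n k) (walk_op n k t) (\<lambda>w. of_real (f (card (m \<inter> w)))) v
    = cis (- real \<mu> * t) * of_real (f (card (m \<inter> v)))"
proof -
  interpret johnson_radial n k using assms(2) by unfold_locales
  let ?V = "johnson_vertices n k"
  have "mapply ?V (walk_op n k t) (\<lambda>w. of_real (f (card (m \<inter> w)))) v
      = exp (- \<i> * t * real \<mu>) * of_real (f (card (m \<inter> v)))"
    unfolding walk_op_def
  proof (rule mexp_eigen[OF finite_johnson_vertices _ assms(4)])
    fix u assume u: "u \<in> ?V"
    have "mapply ?V (\<lambda>u v. - \<i> * complex_of_real t * johnson_laplacian n k u v) (\<lambda>w. of_real (f (card (m \<inter> w)))) u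
        = - \<i> * t * mapply ?V (johnson_laplacian n k) (\<lambda>w. of_real (f (card (m \<inter> w)))) u"
      by (simp add: mapply_def sum_distrib_left mult.assoc sum_negf)
    also have "\<dots> = - \<i> * t * (real \<mu> * f (card (m \<inter> u)))"
      using eig sizes[OF u] by (simp add: laplacian_radial[OF assms(1,3) u] eigen_def)
    finally show "mapply ?V (\<lambda>u v. - \<i> * complex_of_real t * johnson_laplacian n k u v) (\<lambda>w. of_real (f (card (m \<inter> w)))) u
        = - \<i> * t * real \<mu> * of_real (f (card (m \<inter> u)))" by simp
  qed
  then show ?thesis by (simp add: cis_conv_exp mult_ac)
qed

lemma card_inter_sizes:
  assumes "k \<le> n" "m \<in> johnson_vertices n k" "v \<in> johnson_vertices n k"
  shows "card (m \<inter> v) \<in> johnson_radial.sizes n k"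
proof -
  interpret johnson_radial n k using assms(1) by unfold_locales
  have f: "finite m" "finite v" "card m = k" "card v = k" "m \<union> v \<subseteq> {1..n}"
    using assms(2,3) by (auto simp: johnson_vertices_def intro: finite_subset)
  have "card (m \<inter> v) \<le> card m" using f by (intro card_mono) auto
  moreover have "card (m \<union> v) \<le> card {1..n}" using f by (intro card_mono) auto
  ultimately show ?thesis using card_Un_Int[OF f(1,2)] f by (simp add: sizes_def)
qed

lemma card_inter_eq_iff:
  assumes "m \<in> johnson_vertices n k" "v \<in> johnson_vertices n k"
  shows "card (m \<inter> v) = k \<longleftrightarrow> v = m"
proof
  have f: "finite m" "finite v" "card m = k" "card v = k"
    using assms by (auto simp: johnson_vertices_def intro: finite_subset)
  assume c: "card (m \<inter> v) = k"
  have "m \<inter> v = m" by (rule card_subset_eq) (use f c in auto)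
  moreover have "m \<inter> v = v" by (rule card_subset_eq) (use f c in auto)
  ultimately show "v = m" by simp
qed (use assms in \<open>auto simp: johnson_vertices_def\<close>)

text \<open>Expanding a state in the eigencomponents of the marked vertex turns the search problem on
  \<open>J(n,k)\<close> into the one on its spectrum.\<close>
lemma johnson_spectral_search:
  assumes k: "k \<ge> 1" and kn: "k \<le> n"
  obtains Lam p where "spectral_search Lam p" "card Lam \<le> k + 1" "p 0 = 1 / real (n choose k)"
    "\<And>M. 4 * k * k + 2 * k \<le> n \<Longrightarrow> M \<in> Lam \<Longrightarrow> M \<noteq> 0
      \<Longrightarrow> 3 * (\<Sum>\<mu> | \<mu> \<in> Lam \<and> \<mu> < M. p \<mu>) \<le> p M"
    "\<And>m v t0 steps e. m \<in> johnson_vertices n k \<Longrightarrow> v \<in> johnson_vertices n k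
      \<Longrightarrow> spectral_search.exec Lam p steps (spectral_search.walk t0
            (\<lambda>\<mu>. if \<mu> = 0 then 1 / of_real (sqrt (p 0)) else 0)) = (\<lambda>\<mu>. e * spectral_search.one Lam \<mu>)
      \<Longrightarrow> final_state n k m t0 steps v = e * basis_state m v"
proof -
  interpret R: johnson_radial n k using kn by unfold_locales
  let ?V = "johnson_vertices n k"
  obtain g where g:
    "\<And>i. i \<in> R.sizes \<Longrightarrow> (\<Sum>\<mu>\<in>R.lam ` {..k}. g \<mu> i) = (if i = k then 1 else 0)"
    "\<And>\<mu>. \<mu> \<in> R.lam ` {..k} \<Longrightarrow> R.eigen \<mu> (g \<mu>)"
    "\<And>\<mu>. \<mu> \<in> R.lam ` {..k} \<Longrightarrow> g \<mu> k \<ge> 0"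
    "\<And>\<mu> i. \<mu> \<in> R.lam ` {..k} \<Longrightarrow> g \<mu> k = 0 \<Longrightarrow> i \<in> R.sizes \<Longrightarrow> g \<mu> i = 0"
    "\<And>i. i \<in> R.sizes \<Longrightarrow> g 0 i = 1 / real (n choose k)"
    "\<And>M. 4 * k * k + 2 * k \<le> n \<Longrightarrow> 1 \<le> M \<Longrightarrow> M \<le> k
      \<Longrightarrow> 3 * (\<Sum>i<M. g (R.lam i) k) \<le> g (R.lam M) k"
    using R.eigen_decomposition by blast
  define p where "p \<mu> = g \<mu> k" for \<mu>
  \<comment> \<open>Eigenvalues on which |m> has no component are discarded, to make all weights
    positive.\<close>
  define Lam where "Lam = {\<mu> \<in> R.lam ` {..k}. p \<mu> \<noteq> 0}"
  have fin: "finite Lam" by (simp add: Lam_def)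
  have N: "real (n choose k) > 0" using kn by simp
  have p0: "p 0 = 1 / real (n choose k)" unfolding p_def by (rule g(5)[OF R.top_size])
  have sub: "Lam \<subseteq> R.lam ` {..k}" by (auto simp: Lam_def)
  have total: "(\<Sum>\<mu>\<in>Lam. g \<mu> i) = (if i = k then 1 else 0)" if "i \<in> R.sizes" for i
  proof -
    have "(\<Sum>\<mu>\<in>Lam. g \<mu> i) = (\<Sum>\<mu>\<in>R.lam ` {..k}. g \<mu> i)"
      by (rule sum.mono_neutral_left[OF _ sub]) (use g(4)[OF _ _ that] in \<open>auto simp: Lam_def p_def\<close>)
    then show ?thesis using g(1)[OF that] by simp
  qed
  interpret S: spectral_search Lam p
  proof
    show "p \<mu> > 0" if "\<mu> \<in> Lam" for \<mu> using that g(3)[of \<mu>] by (auto simp: Lam_def p_def less_le)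
    show "sum p Lam = 1" using total[OF R.top_size] by (simp add: p_def)
    have "0 \<in> R.lam ` {..k}" by (rule image_eqI[of _ _ 0]) (simp_all add: R.lam_def)
    then show "0 \<in> Lam" using p0 N by (simp add: Lam_def)
  qed (rule fin)
  have card: "card Lam \<le> k + 1"
    using card_mono[OF _ sub] card_image_le[of "{..k}" R.lam] by simp
  have dom: "3 * (\<Sum>\<mu> | \<mu> \<in> Lam \<and> \<mu> < M. p \<mu>) \<le> p M"
    if n: "4 * k * k + 2 * k \<le> n" and M: "M \<in> Lam" "M \<noteq> 0" for M
  proof -
    obtain j where j: "M = R.lam j" "j \<le> k" using M sub by auto
    have j1: "1 \<le> j" using j M(2) by (cases j) (auto simp: R.lam_def)
    have n2: "2 * k \<le> n" using n by linarith
    have "{\<mu> \<in> Lam. \<mu> < M} \<subseteq> R.lam ` {..<j}"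
    proof
      fix \<mu> assume "\<mu> \<in> {\<mu> \<in> Lam. \<mu> < M}"
      then obtain i where i: "\<mu> = R.lam i" "i \<le> k" "R.lam i < R.lam j" using sub j by auto
      then have "i < j" using R.lam_strict_mono[OF n2, of j i] by (metis linorder_neqE_nat less_asym less_irrefl)
      then show "\<mu> \<in> R.lam ` {..<j}" using i by auto
    qed
    then have "(\<Sum>\<mu> | \<mu> \<in> Lam \<and> \<mu> < M. p \<mu>) \<le> (\<Sum>\<mu>\<in>R.lam ` {..<j}. p \<mu>)"
      by (intro sum_mono2) (use g(3) j in \<open>auto simp: p_def\<close>)
    also have "\<dots> = (\<Sum>i<j. p (R.lam i))"
    proof (rule sum.reindex[unfolded comp_def], rule inj_onI)
      fix a b assume "a \<in> {..<j}" "b \<in> {..<j}" "R.lam a = R.lam b"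
      then show "a = b" using R.lam_strict_mono[OF n2, of a b] R.lam_strict_mono[OF n2, of b a] j
        by (cases a b rule: linorder_cases) auto
    qed
    finally show ?thesis using g(6)[OF n j1 j(2)] j by (simp add: p_def)
  qed
  define enc where "enc m a = (\<lambda>v. \<Sum>\<mu>\<in>Lam. a \<mu> * complex_of_real (g \<mu> (card (m \<inter> v))))" for m :: "nat set" and a
  have sizes: "card (m \<inter> v) \<in> R.sizes" if "m \<in> ?V" "v \<in> ?V" for m v
    by (rule card_inter_sizes[OF kn that])
  have walk: "mapply ?V (walk_op n k t) (enc m a) v = enc m (S.walk t a) v"
    if "m \<in> ?V" "v \<in> ?V" for m v t a
  proof -
    have "mapply ?V (walk_op n k t) (\<lambda>w. of_real (g \<mu> (card (m \<inter> w)))) v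
        = cis (- real \<mu> * t) * of_real (g \<mu> (card (m \<inter> v)))" if "\<mu> \<in> Lam" for \<mu>
      by (rule walk_op_eigen[OF k kn \<open>m \<in> ?V\<close> \<open>v \<in> ?V\<close> g(2) sizes]) (use that sub \<open>m \<in> ?V\<close> in auto)
    then show ?thesis unfolding enc_def mapply_sum S.walk_def by (simp add: mult_ac)
  qed
  have one: "enc m S.one v = basis_state m v" if "m \<in> ?V" "v \<in> ?V" for m v
  proof -
    have "enc m S.one v = of_real (\<Sum>\<mu>\<in>Lam. g \<mu> (card (m \<inter> v)))"
      unfolding enc_def of_real_sum by (rule sum.cong) (auto simp: S.one_def)
    then show ?thesis using total[OF sizes[OF that]] card_inter_eq_iff[OF that] by (simp add: basis_state_def)
  qed
  \<comment> \<open>The amplitude at m is the overlap with |m>; this is what turns the search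
    operator into \<open>refl one\<close>.\<close>
  have marked: "enc m a m = S.ip S.one a" if "m \<in> ?V" for m a
  proof -
    have "card (m \<inter> m) = k" using that by (simp add: johnson_vertices_def)
    then show ?thesis unfolding enc_def S.ip_def p_def by (intro sum.cong) (auto simp: S.one_def)
  qed
  have search: "mapply ?V (search_op n k m \<theta>) (enc m a) v = enc m (S.refl S.one \<theta> a) v"
    if "m \<in> ?V" "v \<in> ?V" for m v \<theta> a
  proof -
    have "enc m (S.refl S.one \<theta> a) v = enc m a v + (cis (- \<theta>) - 1) * S.ip S.one a * enc m S.one v"
      unfolding enc_def S.refl_def sum_distrib_left sum.distrib[symmetric]
      by (rule sum.cong) (simp_all add: algebra_simps)
    then show ?thesis using that by (simp add: search_op_apply marked one)
  qed
  have run: "run_alg n k m steps x v = enc m (S.exec steps a) v"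
    if "m \<in> ?V" "v \<in> ?V" "\<And>w. w \<in> ?V \<Longrightarrow> x w = enc m a w" for m v steps x a
    using that(3)
  proof (induction steps arbitrary: x a)
    case Nil
    then show ?case using that(2) by simp
  next
    case (Cons s steps)
    obtain \<theta> t where s: "s = (\<theta>, t)" by (cases s)
    have "mapply ?V (search_op n k m \<theta>) x w = enc m (S.refl S.one \<theta> a) w" if "w \<in> ?V" for w
      using search[OF \<open>m \<in> ?V\<close> that, of \<theta> a] mapply_cong[OF Cons.prems, where A = "search_op n k m \<theta>"] by simp
    from mapply_cong[OF this, where A = "walk_op n k t"]
    have "mapply ?V (walk_op n k t) (mapply ?V (search_op n k m \<theta>) x) w = enc m (S.walk t (S.refl S.one \<theta> a)) w"
      if "w \<in> ?V" for w using walk[OF \<open>m \<in> ?V\<close> that] by simp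
    from Cons.IH[OF this] show ?case by (simp add: s)
  qed
  \<comment> \<open>The uniform state is the normalised zero-eigenvalue component of |m>: that
    component is constantly 1/N, with squared length p(0) = 1/N.\<close>
  define \<delta> :: "nat \<Rightarrow> complex" where "\<delta> = (\<lambda>\<mu>. if \<mu> = 0 then 1 / of_real (sqrt (p 0)) else 0)"
  have init: "unif_state n k v = enc m \<delta> v" if "m \<in> ?V" "v \<in> ?V" for m v
  proof -
    have "enc m \<delta> v = (\<Sum>\<mu>\<in>Lam. if \<mu> = 0 then of_real (g 0 (card (m \<inter> v)) / sqrt (p 0)) else 0)"
      unfolding enc_def \<delta>_def by (rule sum.cong) auto
    also have "\<dots> = of_real (g 0 (card (m \<inter> v)) / sqrt (p 0))"
      using fin S.zero_in by simp
    also have "g 0 (card (m \<inter> v)) / sqrt (p 0) = 1 / sqrt (real (n choose k))"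
      using N unfolding g(5)[OF sizes[OF that]] p0
      by (simp add: real_sqrt_divide real_div_sqrt field_simps)
    finally show ?thesis using that by (simp add: unif_state_def card_johnson_vertices)
  qed
  have final: "final_state n k m t0 steps v = e * basis_state m v"
    if "m \<in> ?V" "v \<in> ?V" "S.exec steps (S.walk t0 \<delta>) = (\<lambda>\<mu>. e * S.one \<mu>)" for m v t0 steps e
  proof -
    have "mapply ?V (walk_op n k t0) (unif_state n k) w = enc m (S.walk t0 \<delta>) w" if "w \<in> ?V" for w
      using walk[OF \<open>m \<in> ?V\<close> that, of t0 \<delta>] mapply_cong[OF init[OF \<open>m \<in> ?V\<close>], where A = "walk_op n k t0"] by simp
    from run[OF that(1,2) this] have "final_state n k m t0 steps v = enc m (\<lambda>\<mu>. e * S.one \<mu>) v"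
      by (simp add: final_state_def that(3))
    also have "\<dots> = e * enc m S.one v" by (simp add: enc_def sum_distrib_left mult.assoc)
    finally show ?thesis using one[OF that(1,2)] by simp
  qed
  show ?thesis
    by (rule that[OF S.spectral_search_axioms card p0 dom final]) (simp_all add: \<delta>_def)
qed

theorem theorem2:
  fixes k :: nat
  assumes "k \<ge> 1"
  shows "\<exists>C::real. C > 0 \<and>
    (\<forall>n::nat. \<exists>(t0::real) (steps::(real \<times> real) list).
       real (length steps) \<le> C * sqrt (real (n choose k)) \<and>
       (\<forall>m \<in> johnson_vertices n k. \<exists>\<phi>::real.
          \<forall>v \<in> johnson_vertices n k.
            final_state n k m t0 steps v = exp (\<i> * of_real \<phi>) * basis_state m v))"
proof -
  define solves where "solves n T \<longleftrightarrow> (\<exists>(t0::real) steps. length steps = T \<and>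
     (\<forall>m \<in> johnson_vertices n k. \<exists>\<phi>::real. \<forall>v \<in> johnson_vertices n k.
        final_state n k m t0 steps v = exp (\<i> * of_real \<phi>) * basis_state m v))" for n T
  have exact: "\<exists>T. solves n T \<and> (4 * k * k + 2 * k \<le> n \<longrightarrow> real T \<le> 9 ^ (k + 1) * sqrt (real (n choose k)))"
    if kn: "k \<le> n" for n
  proof -
    obtain Lam p where S: "spectral_search Lam p" "card Lam \<le> k + 1" "p 0 = 1 / real (n choose k)"
      "\<And>M. 4 * k * k + 2 * k \<le> n \<Longrightarrow> M \<in> Lam \<Longrightarrow> M \<noteq> 0
        \<Longrightarrow> 3 * (\<Sum>\<mu> | \<mu> \<in> Lam \<and> \<mu> < M. p \<mu>) \<le> p M"
      "\<And>m v t0 steps e. m \<in> johnson_vertices n k \<Longrightarrow> v \<in> johnson_vertices n k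
        \<Longrightarrow> spectral_search.exec Lam p steps (spectral_search.walk t0
              (\<lambda>\<mu>. if \<mu> = 0 then 1 / of_real (sqrt (p 0)) else 0)) = (\<lambda>\<mu>. e * spectral_search.one Lam \<mu>)
        \<Longrightarrow> final_state n k m t0 steps v = e * basis_state m v"
      using johnson_spectral_search[OF assms kn] by blast
    interpret spectral_search Lam p by (rule S(1))
    have sol: "solves n T" if reach: "reach T (\<lambda>\<mu>. if \<mu> = 0 then 1 / of_real (sqrt (p 0)) else 0)" for T
    proof -
      from reach obtain t0 steps e where a: "length steps = T" "cmod e = 1"
        "exec steps (walk t0 (\<lambda>\<mu>. if \<mu> = 0 then 1 / of_real (sqrt (p 0)) else 0)) = (\<lambda>\<mu>. e * one \<mu>)"
        by (rule reach_reverse)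
      have "e = exp (\<i> * of_real (Arg e))"
        using rcis_cmod_Arg[of e] a(2) by (simp add: rcis_def cis_conv_exp)
      then show ?thesis unfolding solves_def using a(1) S(5)[OF _ _ a(3)] by metis
    qed
    show ?thesis
    proof (cases "4 * k * k + 2 * k \<le> n")
      case True
      obtain T where T: "reach T (\<lambda>\<mu>. if \<mu> = 0 then 1 / of_real (sqrt (p 0)) else 0)"
        "real T \<le> 9 ^ card Lam / sqrt (p 0)"
        using reach_zero_bound[OF S(4)[OF True]] by blast
      have "9 ^ card Lam / sqrt (p 0) = 9 ^ card Lam * sqrt (real (n choose k))"
        by (simp add: S(3) real_sqrt_divide)
      also have "\<dots> \<le> 9 ^ (k + 1) * sqrt (real (n choose k))"
        by (intro mult_right_mono power_increasing S(2)) auto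
      finally show ?thesis using sol[OF T(1)] T(2) by (intro exI[of _ T]) auto
    qed (use sol reach_zero in blast)
  qed
  have "\<exists>T. solves n T \<and> (4 * k * k + 2 * k \<le> n \<longrightarrow> real T \<le> 9 ^ (k + 1) * sqrt (real (n choose k)))
      \<and> (n < k \<longrightarrow> T = 0)" for n
  proof (cases "k \<le> n")
    \<comment> \<open>Here the binomial coefficient is 0, so the bound permits no call at all; there
      is no vertex to find either.\<close>
    case False
    then have "card (johnson_vertices n k) = 0" by (simp add: card_johnson_vertices)
    then have "johnson_vertices n k = {}" by (simp add: finite_johnson_vertices)
    then have "solves n 0" by (simp add: solves_def)
    then show ?thesis by (intro exI[of _ 0]) simp
  qed (use exact in \<open>auto simp: not_le\<close>)
  then obtain T where T: "\<And>n. solves n (T n)"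
    "\<And>n. 4 * k * k + 2 * k \<le> n \<Longrightarrow> real (T n) \<le> 9 ^ (k + 1) * sqrt (real (n choose k))"
    "\<And>n. n < k \<Longrightarrow> T n = 0" by metis
  \<comment> \<open>The sum absorbs the exact but unestimated costs for the finitely many small n,
    where sqrt N \<ge> 1 once k \<le> n.\<close>
  define C where "C = 9 ^ (k + 1) + (\<Sum>n<4 * k * k + 2 * k. real (T n))"
  have C9: "9 ^ (k + 1) \<le> C" unfolding C_def by (simp add: sum_nonneg)
  have bound: "real (T n) \<le> C * sqrt (real (n choose k))" for n
  proof -
    consider "n < k" | "4 * k * k + 2 * k \<le> n" | "k \<le> n" "n < 4 * k * k + 2 * k" by linarith
    then show ?thesis
    proof cases
      case 1
      then show ?thesis by (simp add: T(3) binomial_eq_0)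
    next
      case 2
      show ?thesis by (rule order_trans[OF T(2)[OF 2] mult_right_mono[OF C9]]) simp
    next
      case 3
      have "real (T n) \<le> (\<Sum>n<4 * k * k + 2 * k. real (T n))"
        by (rule member_le_sum) (use 3 in auto)
      then have "real (T n) \<le> C * 1" by (simp add: C_def add_increasing)
      also have "1 \<le> n choose k" using 3 by (simp add: Suc_leI)
      then have "C * 1 \<le> C * sqrt (real (n choose k))"
        using C9 by (intro mult_left_mono) (auto intro: order_trans[of _ "9 ^ (k + 1)"])
      finally show ?thesis .
    qed
  qed
  have "C > 0" using C9 by (rule less_le_trans[rotated]) simp
  moreover have "\<exists>(t0::real) steps. real (length steps) \<le> C * sqrt (real (n choose k)) \<and>
       (\<forall>m \<in> johnson_vertices n k. \<exists>\<phi>::real. \<forall>v \<in> johnson_vertices n k.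
          final_state n k m t0 steps v = exp (\<i> * of_real \<phi>) * basis_state m v)" for n
    using T(1)[of n] bound[of n] unfolding solves_def by metis
  ultimately show ?thesis by blast
qed

end
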